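(* Let $E$ be a Hilbert $\mathcal{A}$-module over a $C^*$-algebra $\mathcal{A}$, let $A, B_1, B_2 \in L(E)$, and suppose that $R(B_1)+R(B_2)$ is closed. Then the following statements are equivalent: (1) $R(A) \subset R(B_1)+R(B_2)$; (2) $AA^* \leq \lambda (B_1B_1^* + B_2B_2^* )$ for some $\lambda > 0$; (3) there exist $X, Y \in L(E)$ such that $A = B_1X + B_2Y$.
   Context: Hilbert $\mathcal{A}$-modules are left modules with $\mathcal{A}$-valued inner product that is $\mathcal{A}$-linear in the first argument. $L(E)$ denotes the $C^*$-algebra of all adjointable operators on $E$, with its usual order on self-adjoint elements; $R(T)$ denotes the range of $T$. *)

theory Defs
  imports Complex_Main "HOL-Library.Set_Algebras"
begin

class complex_vector = real_vector +
  fixes scaleC :: "complex \<Rightarrow> 'a \<Rightarrow> 'a"  (infixr \<open>*\<^sub>C\<close> 75)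
  assumes scaleC_add_right: "c *\<^sub>C (x + y) = c *\<^sub>C x + c *\<^sub>C y"
    and scaleC_add_left: "(c + d) *\<^sub>C x = c *\<^sub>C x + d *\<^sub>C x"
    and scaleC_scaleC: "c *\<^sub>C (d *\<^sub>C x) = (c * d) *\<^sub>C x"
    and scaleC_of_real: "complex_of_real r *\<^sub>C x = r *\<^sub>R x"

(* Complex C*-algebras; a unit is not required. *)
class cstar_algebra = complex_vector + real_normed_algebra + banach +
  fixes star :: "'a \<Rightarrow> 'a"
  assumes mult_scaleC_left: "(c *\<^sub>C a) * b = c *\<^sub>C (a * b)"
    and mult_scaleC_right: "a * (c *\<^sub>C b) = c *\<^sub>C (a * b)"
    and norm_scaleC: "norm (c *\<^sub>C a) = cmod c * norm a"
    and star_add: "star (a + b) = star a + star b"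
    and star_scaleC: "star (c *\<^sub>C a) = cnj c *\<^sub>C star a"
    and star_mult: "star (a * b) = star b * star a"
    and star_star: "star (star a) = a"
    and cstar_identity: "norm (star a * a) = (norm a)\<^sup>2"

definition cstar_positive :: "'a::cstar_algebra \<Rightarrow> bool" where
  "cstar_positive a \<longleftrightarrow> (\<exists>b. a = star b * b)"

(* The norm of a Hilbert module is the one induced by the inner product (it is a norm by the
   Cauchy-Schwarz inequality). It is taken to be the norm of the type 'e, so that completeness
   of the module is expressed by the class banach and closedness of subsets by closed. *)
locale hilbert_module =
  fixes act :: "'a::cstar_algebra \<Rightarrow> 'e::{complex_vector, banach} \<Rightarrow> 'e"
    and ip :: "'e \<Rightarrow> 'e \<Rightarrow> 'a"
  assumes act_add_left: "act (a + b) x = act a x + act b x"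
    and act_add_right: "act a (x + y) = act a x + act a y"
    and act_mult: "act (a * b) x = act a (act b x)"
    and act_scaleC_left: "act (c *\<^sub>C a) x = c *\<^sub>C act a x"
    and act_scaleC_right: "act a (c *\<^sub>C x) = c *\<^sub>C act a x"
    and ip_add_left: "ip (x + y) z = ip x z + ip y z"
    and ip_scaleC_left: "ip (c *\<^sub>C x) y = c *\<^sub>C ip x y"
    and ip_act_left: "ip (act a x) y = a * ip x y"
    and ip_star: "star (ip x y) = ip y x"
    and ip_positive: "cstar_positive (ip x x)"
    and ip_definite: "ip x x = 0 \<Longrightarrow> x = 0"
    and norm_eq: "norm x = sqrt (norm (ip x x))"

definition is_adjoint :: "('e \<Rightarrow> 'e \<Rightarrow> 'a) \<Rightarrow> ('e \<Rightarrow> 'e) \<Rightarrow> ('e \<Rightarrow> 'e) \<Rightarrow> bool" where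
  "is_adjoint ip T S \<longleftrightarrow> (\<forall>x y. ip (T x) y = ip x (S y))"

(* The algebra L(E) of adjointable operators. Module linearity and boundedness are consequences
   of the existence of an adjoint. *)
definition adjointables :: "('e \<Rightarrow> 'e \<Rightarrow> 'a) \<Rightarrow> ('e \<Rightarrow> 'e) set" where
  "adjointables ip = {T. \<exists>S. is_adjoint ip T S}"

definition adj :: "('e \<Rightarrow> 'e \<Rightarrow> 'a) \<Rightarrow> ('e \<Rightarrow> 'e) \<Rightarrow> ('e \<Rightarrow> 'e)" where
  "adj ip T = (THE S. is_adjoint ip T S)"

definition self_adjoint :: "('e \<Rightarrow> 'e \<Rightarrow> 'a) \<Rightarrow> ('e \<Rightarrow> 'e) \<Rightarrow> bool" where
  "self_adjoint ip T \<longleftrightarrow> T \<in> adjointables ip \<and> adj ip T = T"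

(* Positivity in the C*-algebra L(E), i.e. the counterpart of cstar_positive. *)
definition op_positive :: "('e \<Rightarrow> 'e \<Rightarrow> 'a) \<Rightarrow> ('e \<Rightarrow> 'e) \<Rightarrow> bool" where
  "op_positive ip T \<longleftrightarrow> (\<exists>S \<in> adjointables ip. T = adj ip S \<circ> S)"

definition op_le :: "('e::ab_group_add \<Rightarrow> 'e \<Rightarrow> 'a) \<Rightarrow> ('e \<Rightarrow> 'e) \<Rightarrow> ('e \<Rightarrow> 'e) \<Rightarrow> bool" where
  "op_le ip S T \<longleftrightarrow>
     self_adjoint ip S \<and> self_adjoint ip T \<and> op_positive ip (\<lambda>x. T x - S x)"

end

theory Submission
  imports Defs "HOL-Analysis.Analysis"
begin

text \<open>
Write \<open>T = B1 B1* + B2 B2*\<close> and \<open>M = R(B1) + R(B2)\<close>.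

The heart of the matter is that \<open>T\<close> maps the closed submodule \<open>M\<close> onto itself
(\<open>gram_right_inverse\<close>). By the open mapping theorem every \<open>y\<close> in \<open>M\<close> is
\<open>B1 u + B2 v\<close> with \<open>u, v\<close> bounded by a multiple of \<open>norm y\<close>; pairing this with \<open>y\<close> and
using the Cauchy-Schwarz inequality bounds \<open>norm y\<close> by a multiple of \<open>norm (T y + s y)\<close>,
with a constant that is independent of \<open>s \<ge> 0\<close>. In a Hilbert module a closed submodule may
fail to be complemented, so surjectivity is not obtained from an orthogonal complement but from
the method of continuity: \<open>T + s\<close> is onto for large \<open>s\<close> by a contraction argument, and the
uniform bound carries this down to \<open>s = 0\<close> in steps of fixed size.

Let \<open>G\<close> be a right inverse of \<open>T\<close> on \<open>M\<close>. If \<open>R(A) \<subseteq> M\<close>, then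
\<open>A = T G A = B1 (B1* G A) + B2 (B2* G A)\<close>, and \<open>Bi* G A\<close> has the adjoint \<open>A* G Bi\<close> because
\<open>T\<close> is symmetric; so range inclusion implies
factorization. If \<open>A A* \<le> \<lambda> T\<close>, then \<open>A*\<close> vanishes on the kernel of
\<open>T\<close>, which is orthogonal to \<open>M\<close>; since \<open>x - G T x\<close> lies in that kernel, \<open>G T\<close> acts as
the orthogonal projection onto \<open>M\<close>, and \<open>G T A = A\<close>; so majorization implies range
inclusion. Finally, if
\<open>A = B1 X + B2 Y\<close> and \<open>X X*, Y Y* \<le> t\<close>, then
\<open>2t T - A A* = 2 B1 (t - X X*) B1* + 2 B2 (t - Y Y*) B2* + (B1 X - B2 Y)(B1 X - B2 Y)*\<close>
is a sum of positive operators; so factorization implies majorization.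

All of this presupposes that positivity behaves well, both in the coefficient algebra, where the
norm has to be monotone on positive elements, and in \<open>L(E)\<close>, where a sum of elements
\<open>S* S\<close> has to be of that form again. Both facts come from one development for an abstract unital
\<open>C*\<close>-algebra that avoids spectra. The only functional calculus is the square root of
\<open>1 - x\<close> for \<open>norm x \<le> 1\<close>, by its power series. The cone of self-adjoint \<open>p\<close> with
\<open>norm (t - p) \<le> t\<close> for some \<open>t > 0\<close> is visibly convex, consists of the squares of
self-adjoint elements, and contains every \<open>b* b\<close> by a version of the Kelley-Vaught argument
(\<open>nonneg_st_mult\<close>). It is applied to the adjointable operators on a module for which the
Cauchy-Schwarz inequality is known. The first such module is the coefficient algebra over itself,
in which it sits as right multiplications; the resulting facts about positive elements give the
Cauchy-Schwarz inequality in an arbitrary Hilbert module, to which the development is then applied a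
second time.
\<close>

section \<open>Square roots by power series\<close>

text \<open>The power series of \<open>1 - \<surd>(1 - x)\<close>. The recursion is the comparison of coefficients in
\<open>f\<^sup>2 = 2 f - x\<close>; it makes the coefficients visibly nonnegative.\<close>

fun sqrt_coeff :: "nat \<Rightarrow> real" where
  "sqrt_coeff n = (if n = 0 then 0 else if n = 1 then 1 / 2
     else (\<Sum>k\<in>{1..<n}. sqrt_coeff k * sqrt_coeff (n - k)) / 2)"

declare sqrt_coeff.simps [simp del]

lemma sqrt_coeff_0 [simp]: "sqrt_coeff 0 = 0"
  by (simp add: sqrt_coeff.simps)

lemma sqrt_coeff_nonneg: "0 \<le> sqrt_coeff n"
proof (induction n rule: less_induct)
  case (less n)
  have "0 \<le> (\<Sum>k\<in>{1..<n}. sqrt_coeff k * sqrt_coeff (n - k))"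
    by (rule sum_nonneg) (auto intro!: mult_nonneg_nonneg less)
  then show ?case by (subst sqrt_coeff.simps) auto
qed

lemma sqrt_coeff_convolution:
  "(\<Sum>k\<le>n. sqrt_coeff k * sqrt_coeff (n - k)) = 2 * sqrt_coeff n - (if n = 1 then 1 else 0)"
proof (cases "n \<le> 1")
  case True
  then consider "n = 0" | "n = 1" by linarith
  then show ?thesis
    by cases (simp_all add: sqrt_coeff.simps[of "Suc 0"])
next
  case False
  have "(\<Sum>k\<le>n. sqrt_coeff k * sqrt_coeff (n - k)) = (\<Sum>k\<in>{1..<n}. sqrt_coeff k * sqrt_coeff (n - k))"
  proof (rule sum.mono_neutral_right)
    show "\<forall>i\<in>{..n} - {1..<n}. sqrt_coeff i * sqrt_coeff (n - i) = 0"
    proof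
      fix i assume "i \<in> {..n} - {1..<n}"
      then have "i = 0 \<or> i = n" by auto
      then show "sqrt_coeff i * sqrt_coeff (n - i) = 0" by auto
    qed
  qed auto
  then show ?thesis
    using False by (simp add: sqrt_coeff.simps[of n])
qed

text \<open>If \<open>S N\<close> is the sum of the first \<open>N\<close> coefficients, the recursion bounds \<open>2 S (N + 1)\<close> by
\<open>1 + (S N)\<^sup>2\<close>, and \<open>1\<close> is a fixed point of \<open>s \<mapsto> (1 + s\<^sup>2) / 2\<close>.\<close>

lemma sum_sqrt_coeff_le_1: "(\<Sum>n<N. sqrt_coeff n) \<le> 1"
proof (induction N)
  case (Suc N)
  let ?c = sqrt_coeff
  have "2 * (\<Sum>n<Suc N. ?c n) \<le> 1 + (\<Sum>n<Suc N. \<Sum>k\<le>n. ?c k * ?c (n - k))"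
    by (simp only: sqrt_coeff_convolution sum_subtractf sum_distrib_left [symmetric]) simp
  also have "(\<Sum>n<Suc N. \<Sum>k\<le>n. ?c k * ?c (n - k)) = (\<Sum>(i, j)\<in>{(i, j). i + j < Suc N}. ?c i * ?c j)"
    by (rule sum.triangle_reindex [symmetric])
  also have "\<dots> = (\<Sum>(i, j)\<in>{(i, j). i + j < Suc N} \<inter> {..<N} \<times> {..<N}. ?c i * ?c j)"
  proof (rule sum.mono_neutral_right)
    show "finite {(i, j). i + j < Suc N}"
      by (rule finite_subset [of _ "{..N} \<times> {..N}"]) auto
    show "\<forall>z\<in>{(i, j). i + j < Suc N} - {(i, j). i + j < Suc N} \<inter> {..<N} \<times> {..<N}.
        (case z of (i, j) \<Rightarrow> ?c i * ?c j) = 0"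
    proof
      fix z assume z: "z \<in> {(i, j). i + j < Suc N} - {(i, j). i + j < Suc N} \<inter> {..<N} \<times> {..<N}"
      obtain i j where [simp]: "z = (i, j)" by (cases z)
      have "i = 0 \<or> j = 0" using z by auto
      then show "(case z of (i, j) \<Rightarrow> ?c i * ?c j) = 0" by auto
    qed
  qed auto
  also have "\<dots> \<le> (\<Sum>(i, j)\<in>{..<N} \<times> {..<N}. ?c i * ?c j)"
    by (rule sum_mono2) (auto intro!: mult_nonneg_nonneg sqrt_coeff_nonneg)
  also have "\<dots> = (\<Sum>n<N. ?c n) * (\<Sum>n<N. ?c n)"
    by (simp add: sum_product sum.cartesian_product)
  also have "\<dots> \<le> 1 * 1"
    by (rule mult_mono) (use Suc in \<open>auto intro!: sum_nonneg sqrt_coeff_nonneg\<close>)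
  finally show ?case by simp
qed simp

lemma summable_sqrt_coeff: "summable sqrt_coeff"
  by (rule summableI_nonneg_bounded [OF sqrt_coeff_nonneg sum_sqrt_coeff_le_1])

lemma suminf_sqrt_coeff_le_1: "suminf sqrt_coeff \<le> 1"
  by (rule suminf_le_const [OF summable_sqrt_coeff sum_sqrt_coeff_le_1])

text \<open>The bound on the coefficient sum makes the series converge absolutely on the closed unit ball,
and the Cauchy product turns the recursion into \<open>f\<^sup>2 = 2 f - x\<close>.\<close>

lemma sqrt_one_minus_series:
  fixes x :: "'b::{real_normed_algebra,banach,monoid_mult}"
  assumes "norm x \<le> 1"
  defines "f \<equiv> (\<Sum>n. sqrt_coeff n *\<^sub>R x ^ n)"
  shows "(\<lambda>n. sqrt_coeff n *\<^sub>R x ^ n) sums f" "norm f \<le> 1" "(1 - f) * (1 - f) = 1 - x"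
proof -
  let ?g = "\<lambda>n. sqrt_coeff n *\<^sub>R x ^ n"
  have pow: "norm (x ^ Suc n) \<le> 1" for n
  proof (induction n)
    case (Suc n)
    have "norm (x ^ Suc (Suc n)) \<le> norm x * norm (x ^ Suc n)"
      by (simp only: power_Suc[of x "Suc n"]) (rule norm_mult_ineq)
    also have "\<dots> \<le> 1 * 1"
      using assms(1) Suc by (intro mult_mono) auto
    finally show ?case by simp
  qed (use assms(1) in simp)
  have bound: "norm (?g n) \<le> sqrt_coeff n" for n
    using mult_left_mono[OF pow[of "n - 1"] sqrt_coeff_nonneg[of n]]
    by (cases n) (simp_all add: sqrt_coeff_nonneg abs_of_nonneg)
  have sn: "summable (\<lambda>n. norm (?g n))"
    by (rule summable_comparison_test'[OF summable_sqrt_coeff, of 0]) (simp add: bound[simplified])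
  show s: "?g sums f"
    unfolding f_def by (rule summable_sums[OF summable_norm_cancel[OF sn]])
  have "norm f \<le> (\<Sum>n. norm (?g n))"
    unfolding f_def by (rule summable_norm[OF sn])
  also have "\<dots> \<le> suminf sqrt_coeff"
    by (rule suminf_le[OF bound sn summable_sqrt_coeff])
  also note suminf_sqrt_coeff_le_1
  finally show "norm f \<le> 1" .
  have "(\<lambda>n. \<Sum>i\<le>n. ?g i * ?g (n - i)) sums (f * f)"
    unfolding f_def by (rule Cauchy_product_sums[OF sn sn])
  moreover have "(\<Sum>i\<le>n. ?g i * ?g (n - i)) = 2 *\<^sub>R ?g n - (if n = 1 then x else 0)" for n
  proof -
    have "(\<Sum>i\<le>n. ?g i * ?g (n - i)) = (\<Sum>i\<le>n. (sqrt_coeff i * sqrt_coeff (n - i)) *\<^sub>R x ^ n)"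
      by (rule sum.cong) (auto simp: power_add[symmetric])
    also have "\<dots> = (2 * sqrt_coeff n - (if n = 1 then 1 else 0)) *\<^sub>R x ^ n"
      by (simp only: scaleR_left.sum[symmetric] sqrt_coeff_convolution)
    finally show ?thesis by (auto simp: scaleR_left_diff_distrib)
  qed
  ultimately have "(\<lambda>n. 2 *\<^sub>R ?g n - (if n = 1 then x else 0)) sums (f * f)" by simp
  moreover have "(\<lambda>n. 2 *\<^sub>R ?g n - (if n = 1 then x else 0)) sums (2 *\<^sub>R f - x)"
    by (rule sums_diff[OF sums_scaleR_right[OF s] sums_single])
  ultimately have "f * f = 2 *\<^sub>R f - x" by (rule sums_unique2)
  then show "(1 - f) * (1 - f) = 1 - x"
    by (simp add: algebra_simps scaleR_2)
qed

section \<open>The positive cone of a unital C*-algebra\<close>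

text \<open>The algebra is a subset of a Banach algebra, because the adjointable operators are only some of the
bounded ones and the involution exists only for them. The central element \<open>J\<close> is multiplication by the
imaginary unit; it encodes the complex structure.\<close>

locale unital_cstar =
  fixes C :: "'b::{real_normed_algebra,banach,monoid_mult} set"
    and st :: "'b \<Rightarrow> 'b" and J :: 'b
  assumes closed_sa: "closed {h \<in> C. st h = h}"
    and one_in: "1 \<in> C" and J_in: "J \<in> C"
    and add_in: "\<lbrakk>a \<in> C; b \<in> C\<rbrakk> \<Longrightarrow> a + b \<in> C"
    and mult_in: "\<lbrakk>a \<in> C; b \<in> C\<rbrakk> \<Longrightarrow> a * b \<in> C"
    and scaleR_in: "a \<in> C \<Longrightarrow> t *\<^sub>R a \<in> C"
    and st_in: "a \<in> C \<Longrightarrow> st a \<in> C"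
    and st_add: "\<lbrakk>a \<in> C; b \<in> C\<rbrakk> \<Longrightarrow> st (a + b) = st a + st b"
    and st_scaleR: "a \<in> C \<Longrightarrow> st (t *\<^sub>R a) = t *\<^sub>R st a"
    and st_mult: "\<lbrakk>a \<in> C; b \<in> C\<rbrakk> \<Longrightarrow> st (a * b) = st b * st a"
    and st_st: "a \<in> C \<Longrightarrow> st (st a) = a"
    and cstar: "a \<in> C \<Longrightarrow> norm (st a * a) = (norm a)\<^sup>2"
    and J_sq: "J * J = - 1"
    and J_comm: "a \<in> C \<Longrightarrow> J * a = a * J"
    and st_J: "st J = - J"
begin

lemma minus_in: "a \<in> C \<Longrightarrow> - a \<in> C"
  using scaleR_in[of a "-1"] by simp

lemma diff_in: "\<lbrakk>a \<in> C; b \<in> C\<rbrakk> \<Longrightarrow> a - b \<in> C"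
  using add_in[of a "- b"] minus_in by simp

lemma st_minus: "a \<in> C \<Longrightarrow> st (- a) = - st a"
  using st_scaleR[of a "-1"] by simp

lemma st_diff: "\<lbrakk>a \<in> C; b \<in> C\<rbrakk> \<Longrightarrow> st (a - b) = st a - st b"
  using st_add[of a "- b"] minus_in st_minus by simp

lemma st_1: "st 1 = 1"
  using st_mult[OF one_in st_in[OF one_in]] by (simp add: st_st one_in)

lemma norm_st: assumes "a \<in> C" shows "norm (st a) = norm a"
proof -
  have le: "norm b \<le> norm (st b)" if "b \<in> C" for b
  proof (cases "norm b = 0")
    case False
    have "(norm b)\<^sup>2 \<le> norm (st b) * norm b"
      using norm_mult_ineq[of "st b" b] cstar[OF that] by simp
    then show ?thesis using False by (simp add: power2_eq_square)
  qed simp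
  show ?thesis using le[OF assms] le[OF st_in[OF assms]] assms by (simp add: st_st)
qed

lemma cstar': "a \<in> C \<Longrightarrow> norm (a * st a) = (norm a)\<^sup>2"
  using cstar[OF st_in] by (simp add: st_st norm_st)

lemma norm_1_le: "norm (1 :: 'b) \<le> 1"
proof -
  have "norm (1::'b) = norm (1::'b) * norm (1::'b)"
    using cstar[OF one_in] by (simp add: st_1 power2_eq_square)
  then show ?thesis by (metis mult_cancel_left1 order_refl zero_le_one)
qed

definition sa :: "'b \<Rightarrow> bool" where "sa h \<longleftrightarrow> h \<in> C \<and> st h = h"

lemma sa_in: "sa h \<Longrightarrow> h \<in> C" and sa_st: "sa h \<Longrightarrow> st h = h"
  by (auto simp: sa_def)

lemma sa_1: "sa 1" by (simp add: sa_def one_in st_1)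

lemma sa_0: "sa 0"
  using scaleR_in[OF one_in, of 0] st_scaleR[OF one_in, of 0] by (simp add: sa_def)

lemma sa_add: "\<lbrakk>sa h; sa k\<rbrakk> \<Longrightarrow> sa (h + k)"
  by (simp add: sa_def add_in st_add)

lemma sa_diff: "\<lbrakk>sa h; sa k\<rbrakk> \<Longrightarrow> sa (h - k)"
  by (simp add: sa_def diff_in st_diff)

lemma sa_scaleR: "sa h \<Longrightarrow> sa (t *\<^sub>R h)"
  by (simp add: sa_def scaleR_in st_scaleR)

lemma sa_mult: "\<lbrakk>sa h; sa k; h * k = k * h\<rbrakk> \<Longrightarrow> sa (h * k)"
  by (simp add: sa_def mult_in st_mult)

lemma sa_st_mult: "a \<in> C \<Longrightarrow> sa (st a * a)"
  by (simp add: sa_def mult_in st_mult st_in st_st)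

lemma sa_mult_st: "a \<in> C \<Longrightarrow> sa (a * st a)"
  by (simp add: sa_def mult_in st_mult st_in st_st)

lemma norm_sa_square: "sa h \<Longrightarrow> norm (h * h) = (norm h)\<^sup>2"
  using cstar[of h] by (simp add: sa_def)

lemma sa_square_eq_0: "sa h \<Longrightarrow> h * h = 0 \<Longrightarrow> h = 0"
  using norm_sa_square[of h] by simp

text \<open>The self-adjoint elements commuting with \<open>y\<close> are closed under limits, and the powers of \<open>x\<close> are among
them. The bound on \<open>1 - k\<close> will place the root in the positive cone.\<close>

lemma sqrt_one_minus:
  assumes "sa x" "norm x \<le> 1"
  obtains k where "sa k" "k * k = 1 - x" "norm (1 - k) \<le> 1" "\<And>y. x * y = y * x \<Longrightarrow> k * y = y * k"
proof
  define f where "f = (\<Sum>n. sqrt_coeff n *\<^sub>R x ^ n)"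
  note f = sqrt_one_minus_series[OF assms(2), folded f_def]
  have pow: "sa (x ^ n)" for n
  proof (induction n)
    case (Suc n)
    then show ?case by (simp add: sa_mult assms(1) power_commutes)
  qed (simp add: sa_1)
  have "sa f"
  proof -
    define S where "S n = (\<Sum>i<n. sqrt_coeff i *\<^sub>R x ^ i)" for n
    have "sa (S n)" for n
      by (induction n) (simp_all add: S_def sa_0 sa_add sa_scaleR pow)
    then have "\<forall>n. S n \<in> {h \<in> C. st h = h}" by (simp add: sa_def)
    moreover have "S \<longlonglongrightarrow> f"
      using f(1) unfolding sums_def S_def .
    ultimately have "f \<in> {h \<in> C. st h = h}"
      using closed_sa unfolding closed_sequential_limits by blast
    then show ?thesis by (simp add: sa_def)
  qed
  then show "sa (1 - f)" by (simp add: sa_diff sa_1)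
  show "(1 - f) * (1 - f) = 1 - x" "norm (1 - (1 - f)) \<le> 1" using f by auto
  fix y assume y: "x * y = y * x"
  have yn: "x ^ n * y = y * x ^ n" for n
  proof (induction n)
    case (Suc n)
    have "x ^ Suc n * y = x * (x ^ n * y)" by (simp add: mult.assoc)
    also have "\<dots> = (x * y) * x ^ n" by (simp only: Suc mult.assoc)
    finally show ?case by (simp add: y mult.assoc)
  qed simp
  have "(\<lambda>n. (sqrt_coeff n *\<^sub>R x ^ n) * y) sums (f * y)"
    by (rule sums_mult2[OF f(1)])
  moreover have "(\<lambda>n. y * (sqrt_coeff n *\<^sub>R x ^ n)) sums (y * f)"
    by (rule sums_mult[OF f(1)])
  ultimately have "f * y = y * f"
    by (simp add: yn sums_iff)
  then show "(1 - f) * y = y * (1 - f)" by (simp add: algebra_simps)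
qed

text \<open>Arens' trick: the commuting elements combine to \<open>z = h + J k\<close> with \<open>z* z = h\<^sup>2 + k\<^sup>2\<close>, and
\<open>h\<close> is the real part of \<open>z\<close>, so that its norm is at most that of \<open>z\<close>.\<close>

lemma norm_square_le_add_commuting:
  assumes h: "sa h" and k: "sa k" and hk: "h * k = k * h"
  shows "norm (h * h) \<le> norm (h * h + k * k)"
proof -
  note C = sa_in[OF h] sa_in[OF k] J_in
  define z where "z = h + J * k"
  have zC: "z \<in> C" by (simp add: z_def C add_in mult_in)
  have st: "st z = h - J * k"
    by (simp add: z_def C st_add st_mult mult_in st_J sa_st[OF h] sa_st[OF k] J_comm[OF C(2)])
  have eq: "st z * z = h * h + k * k"
  proof -
    have "h * (J * k) = J * k * h"
      by (simp add: mult.assoc[symmetric] J_comm[OF C(1), symmetric]) (simp add: mult.assoc hk)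
    moreover have "J * k * (J * k) = - (k * k)"
    proof -
      have "J * k * (J * k) = J * (k * J) * k" by (simp add: mult.assoc)
      also have "\<dots> = (J * J) * (k * k)" by (simp add: J_comm[OF C(2), symmetric] mult.assoc)
      finally show ?thesis by (simp add: J_sq)
    qed
    ultimately show ?thesis
      unfolding st by (simp add: z_def algebra_simps)
  qed
  have "2 * norm h = norm (z + st z)"
    unfolding st by (simp add: z_def flip: scaleR_2)
  also have "\<dots> \<le> norm z + norm z"
    using norm_triangle_ineq[of z "st z"] by (simp add: norm_st[OF zC])
  finally have "norm h \<le> norm z" by simp
  then have "(norm h)\<^sup>2 \<le> (norm z)\<^sup>2" by (simp add: power_mono)
  then show ?thesis using cstar[OF zC] eq norm_sa_square[OF h] by simp
qed

text \<open>For the spectrum this says that it lies in \<open>{0..2 t}\<close>. With \<open>t\<close> quantified existentially, closure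
under addition is the triangle inequality.\<close>

definition nonneg :: "'b \<Rightarrow> bool" where
  "nonneg p \<longleftrightarrow> sa p \<and> (\<exists>t>0. norm (t *\<^sub>R 1 - p) \<le> t)"

lemma nonneg_sa: "nonneg p \<Longrightarrow> sa p" by (simp add: nonneg_def)

lemma nonneg_add: assumes "nonneg p" "nonneg q" shows "nonneg (p + q)"
proof -
  obtain t u where t: "t > 0" "norm (t *\<^sub>R 1 - p) \<le> t" and u: "u > 0" "norm (u *\<^sub>R 1 - q) \<le> u"
    using assms by (auto simp: nonneg_def)
  have "(t + u) *\<^sub>R 1 - (p + q) = (t *\<^sub>R 1 - p) + (u *\<^sub>R 1 - q)"
    by (simp add: algebra_simps)
  then have "norm ((t + u) *\<^sub>R 1 - (p + q)) = norm ((t *\<^sub>R 1 - p) + (u *\<^sub>R 1 - q))"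
    by (rule arg_cong)
  then have "norm ((t + u) *\<^sub>R 1 - (p + q)) \<le> t + u"
    using norm_triangle_ineq[of "t *\<^sub>R 1 - p" "u *\<^sub>R 1 - q"] t u by linarith
  then show ?thesis
    using assms t u by (auto simp: nonneg_def sa_add intro!: exI[of _ "t + u"])
qed

lemma nonneg_scaleR: assumes "nonneg p" "c \<ge> 0" shows "nonneg (c *\<^sub>R p)"
proof (cases "c = 0")
  case True
  then show ?thesis by (auto simp: nonneg_def sa_0 norm_1_le intro!: exI[of _ 1])
next
  case False
  obtain t where t: "t > 0" "norm (t *\<^sub>R 1 - p) \<le> t"
    using assms by (auto simp: nonneg_def)
  have "norm ((c * t) *\<^sub>R 1 - c *\<^sub>R p) = c * norm (t *\<^sub>R 1 - p)"
    using assms(2) by (simp flip: scaleR_scaleR scaleR_diff_right)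
  also have "\<dots> \<le> c * t" using t assms(2) by (simp add: mult_left_mono)
  finally show ?thesis
    using assms False t by (auto simp: nonneg_def sa_scaleR intro!: exI[of _ "c * t"])
qed

lemma nonneg_one: "nonneg 1"
  by (auto simp: nonneg_def sa_1 intro!: exI[of _ 1])

text \<open>Scale so that \<open>norm (h\<^sup>2) \<le> 1\<close> and take \<open>k\<close> with \<open>k\<^sup>2 = 1 - h\<^sup>2\<close>. It commutes with \<open>h\<close>,
so Arens' trick gives \<open>norm (1 - h\<^sup>2) = norm (k\<^sup>2) \<le> norm (k\<^sup>2 + h\<^sup>2) \<le> 1\<close>.\<close>

lemma nonneg_square: assumes "sa h" shows "nonneg (h * h)"
proof -
  \<comment> \<open>The summand \<open>1\<close> keeps \<open>t\<close> positive when \<open>h = 0\<close>.\<close>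
  define t where "t = (norm h)\<^sup>2 + 1"
  define s where "s = 1 / sqrt t"
  have t: "t > 0" unfolding t_def by (smt (verit) zero_le_power2)
  have ss: "s * s = 1 / t" using t by (simp add: s_def)
  define g where "g = s *\<^sub>R h"
  have g: "sa g" by (simp add: g_def assms sa_scaleR)
  have gg: "g * g = (1 / t) *\<^sub>R (h * h)" by (simp add: g_def ss)
  have "norm (g * g) \<le> 1"
    using t by (simp add: gg norm_sa_square[OF assms] t_def)
  then obtain k where k: "sa k" "k * k = 1 - g * g" "\<And>y. g * g * y = y * (g * g) \<Longrightarrow> k * y = y * k"
    using sqrt_one_minus[of "g * g"] g by (metis sa_mult)
  have "norm (k * k) \<le> norm (k * k + g * g)"
    by (rule norm_square_le_add_commuting) (simp_all add: k(1) g k(3)[of g] mult.assoc)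
  then have "norm (1 - g * g) \<le> 1" using norm_1_le by (simp add: k(2))
  then have "norm (t *\<^sub>R (1 - g * g)) \<le> t" using t by simp
  moreover have "t *\<^sub>R (1 - g * g) = t *\<^sub>R 1 - h * h"
    using t by (simp add: gg scaleR_diff_right)
  ultimately show ?thesis
    using t assms by (auto simp: nonneg_def sa_mult)
qed

text \<open>The root commutes with everything that commutes with \<open>p\<close>: this bicommutant property is what lets
the roots of commuting elements commute.\<close>

lemma nonneg_sqrt:
  assumes "nonneg p"
  obtains k where "nonneg k" "k * k = p" "\<And>y. p * y = y * p \<Longrightarrow> k * y = y * k"
proof -
  obtain t where t: "t > 0" "norm (t *\<^sub>R 1 - p) \<le> t" and p: "sa p"
    using assms by (auto simp: nonneg_def)
  define x where "x = 1 - (1 / t) *\<^sub>R p"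
  have "x = (1 / t) *\<^sub>R (t *\<^sub>R 1 - p)"
    using t by (simp add: x_def scaleR_diff_right)
  then have "norm x \<le> 1" using t by simp
  moreover have "sa x" by (simp add: x_def sa_diff sa_1 sa_scaleR p)
  ultimately obtain k where k: "sa k" "k * k = 1 - x" "norm (1 - k) \<le> 1"
    "\<And>y. x * y = y * x \<Longrightarrow> k * y = y * k"
    using sqrt_one_minus by metis
  have "nonneg k" using k(1,3) by (auto simp: nonneg_def intro!: exI[of _ 1])
  show ?thesis
  proof
    show "nonneg (sqrt t *\<^sub>R k)" using \<open>nonneg k\<close> t by (simp add: nonneg_scaleR)
    show "(sqrt t *\<^sub>R k) * (sqrt t *\<^sub>R k) = p" using t by (simp add: x_def k(2))
    fix y assume "p * y = y * p"
    then have "x * y = y * x" by (simp add: x_def algebra_simps)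
    then show "(sqrt t *\<^sub>R k) * y = y * (sqrt t *\<^sub>R k)" using k(4)[of y] by simp
  qed
qed

lemma nonneg_mult_commuting:
  assumes "nonneg p" "nonneg q" "p * q = q * p"
  shows "nonneg (p * q)"
proof -
  obtain k where k: "nonneg k" "k * k = p" "\<And>y. p * y = y * p \<Longrightarrow> k * y = y * k"
    using nonneg_sqrt[OF assms(1)] by blast
  obtain l where l: "nonneg l" "l * l = q" "\<And>y. q * y = y * q \<Longrightarrow> l * y = y * l"
    using nonneg_sqrt[OF assms(2)] by blast
  have kl: "k * l = l * k" using l(3)[of k] k(3)[of q] assms(3) by metis
  have "p * q = k * l * (k * l)"
    unfolding k(2)[symmetric] l(2)[symmetric] by (metis kl mult.assoc)
  moreover have "sa (k * l)" using k(1) l(1) kl by (simp add: sa_mult nonneg_sa)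
  ultimately show ?thesis using nonneg_square by metis
qed

lemma nonneg_norm_minus:
  assumes "sa x" "norm x \<le> t" shows "nonneg (t *\<^sub>R 1 - x)"
proof -
  have t: "t \<ge> 0" using assms(2) norm_ge_zero order_trans by blast
  have "norm ((t + 1) *\<^sub>R 1 - (t *\<^sub>R 1 - x)) \<le> norm (1::'b) + norm x"
    using norm_triangle_ineq[of 1 x] by (simp add: algebra_simps)
  also have "\<dots> \<le> t + 1" using norm_1_le assms by simp
  finally show ?thesis
    using t assms(1) by (auto simp: nonneg_def sa_diff sa_scaleR sa_1 intro!: exI[of _ "t + 1"])
qed

text \<open>The roots of \<open>p\<close> and of \<open>t - p\<close> commute, and their squares add up to \<open>t\<close>; so Arens' trick applies.\<close>

lemma norm_le_of_nonneg_diff: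
  assumes "nonneg p" "nonneg (t *\<^sub>R 1 - p)" "t \<ge> 0"
  shows "norm p \<le> t"
proof -
  obtain l where l: "nonneg l" "l * l = p" "\<And>y. p * y = y * p \<Longrightarrow> l * y = y * l"
    using nonneg_sqrt[OF assms(1)] by blast
  obtain k where k: "nonneg k" "k * k = t *\<^sub>R 1 - p" 
    "\<And>y. (t *\<^sub>R 1 - p) * y = y * (t *\<^sub>R 1 - p) \<Longrightarrow> k * y = y * k"
    using nonneg_sqrt[OF assms(2)] by blast
  have "p * l = l * p" using l(2) by (metis mult.assoc)
  then have "k * l = l * k" using k(3)[of l] by (simp add: algebra_simps)
  then have "norm (l * l) \<le> norm (l * l + k * k)"
    by (intro norm_square_le_add_commuting) (simp_all add: k(1) l(1) nonneg_sa)
  also have "\<dots> = norm (t *\<^sub>R (1::'b))" by (simp add: k(2) l(2))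
  also have "\<dots> \<le> t" using norm_1_le assms(3) by (simp add: mult_left_le)
  finally show ?thesis by (simp add: l(2))
qed

lemma norm_mono:
  assumes "nonneg p" "nonneg q" shows "norm p \<le> norm (p + q)"
proof (rule norm_le_of_nonneg_diff[OF assms(1)])
  let ?t = "norm (p + q)"
  have "nonneg (?t *\<^sub>R 1 - (p + q))"
    using assms by (intro nonneg_norm_minus) (auto simp: sa_add nonneg_sa)
  then have "nonneg (?t *\<^sub>R 1 - (p + q) + q)" using assms(2) by (rule nonneg_add)
  then show "nonneg (?t *\<^sub>R 1 - p)" by (simp add: algebra_simps)
qed simp

text \<open>The elements \<open>c* c\<close> and \<open>c c*\<close> have the same nonzero spectrum, while their sum is a sum of squares,
so they cannot have opposite signs unless \<open>c = 0\<close>. Without spectra the argument is as follows. Let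
\<open>q = - c* c \<ge> 0\<close>. Then \<open>p = c c*\<close> is nonneg as well, and \<open>p c = - c q\<close>, so that
\<open>(1 + p) c = c (1 - q)\<close>. After scaling, \<open>norm (1 - q) \<le> 1\<close>, hence multiplication of \<open>c\<close> by
\<open>1 + p\<close> does not increase its norm. For \<open>r = norm p\<close> this says \<open>(1 + p) p (1 + p) \<le> r\<close>,
which is impossible for \<open>r > 0\<close> because the left-hand side attains \<open>r (1 + r)\<^sup>2\<close>. The last step is made
algebraic by writing \<open>r + 2 r\<^sup>2\<close> as \<open>(1 + 4 r) p\<close> plus positive terms.\<close>

lemma st_mult_nonpos_imp_0:
  assumes c: "c \<in> C" and neg: "nonneg (- (st c * c))"
  shows "c = 0"
proof -
  have reduced: "c = 0" if c: "c \<in> C" and q: "nonneg (- (st c * c))" and n1: "norm (1 + st c * c) \<le> 1" for c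
  proof -
    define q where "q = - (st c * c)"
    define p where "p = c * st c"
    \<comment> \<open>Twice the real and imaginary parts of \<open>c\<close>, so that \<open>u\<^sup>2 + v\<^sup>2 = 2 (c c* + c* c)\<close>.\<close>
    define u where "u = c + st c"
    define v where "v = J * (st c - c)"
    define r where "r = norm p"
    note C = c st_in[OF c] diff_in[OF st_in[OF c] c]
    have sp: "sa p" unfolding p_def by (rule sa_mult_st[OF c])
    have su: "sa u" by (simp add: u_def sa_def add_in C st_add st_st add.commute)
    have sv: "sa v"
      by (simp add: v_def sa_def mult_in J_in C st_mult st_J st_diff st_st J_comm[OF C(3)])
        (simp add: algebra_simps J_comm[OF c] J_comm[OF st_in[OF c]])
    have vv: "v * v = - ((st c - c) * (st c - c))"
    proof -
      have "v * v = J * ((st c - c) * J) * (st c - c)" by (simp add: v_def mult.assoc)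
      also have "\<dots> = (J * J) * ((st c - c) * (st c - c))"
        by (simp only: J_comm[OF C(3), symmetric] mult.assoc)
      finally show ?thesis by (simp add: J_sq)
    qed
    have "u * u + v * v = 2 *\<^sub>R (p - q)"
      unfolding vv by (simp add: u_def p_def q_def algebra_simps scaleR_2)
    then have "p = (1 / 2) *\<^sub>R (u * u + v * v) + q"
      by simp
    then have p: "nonneg p"
      using q[folded q_def] by (simp only: nonneg_add nonneg_scaleR nonneg_square su sv)
    define w where "w = 1 + p"
    have sw: "sa w" by (simp add: w_def sa_add sa_1 sp)
    have wc: "w * c = c * (1 - q)"
      by (simp add: w_def p_def q_def algebra_simps)
    have "norm (w * c) \<le> norm c"
    proof -
      have "norm (w * c) \<le> norm c * norm (1 - q)" unfolding wc by (rule norm_mult_ineq)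
      also have "\<dots> \<le> norm c * 1" using n1 by (intro mult_left_mono) (simp_all add: q_def)
      finally show ?thesis by simp
    qed
    then have "(norm (w * c))\<^sup>2 \<le> (norm c)\<^sup>2" by (simp add: power_mono)
    moreover have "(w * c) * st (w * c) = w * p * w"
      by (simp add: p_def st_mult sa_in[OF sw] sa_st[OF sw] c mult.assoc)
    ultimately have nwpw: "norm (w * p * w) \<le> r"
      using cstar'[OF mult_in[OF sa_in[OF sw] c]] cstar'[OF c] by (simp add: r_def p_def)
    have wpw: "w * p * w = p + 2 *\<^sub>R (p * p) + p * (p * p)"
      by (simp add: w_def algebra_simps scaleR_2)
    have "nonneg (r *\<^sub>R 1 - w * p * w)"
    proof (rule nonneg_norm_minus[OF _ nwpw])
      show "sa (w * p * w)"
        unfolding wpw by (simp add: sa_add sa_scaleR sa_mult sp mult.assoc)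
    qed
    moreover have "nonneg (p * (p * p))"
      by (rule nonneg_mult_commuting[OF p nonneg_square[OF sp]]) (simp add: mult.assoc)
    ultimately have 1: "nonneg (r *\<^sub>R 1 - w * p * w + p * (p * p))" by (rule nonneg_add)
    have 2: "nonneg (2 *\<^sub>R ((r *\<^sub>R 1 - p) * (r *\<^sub>R 1 - p)))"
      by (simp add: nonneg_scaleR nonneg_square sa_diff sa_scaleR sa_1 sp)
    have sq: "(r *\<^sub>R 1 - p) * (r *\<^sub>R 1 - p) = (r * r) *\<^sub>R 1 - r *\<^sub>R p - r *\<^sub>R p + p * p"
      by (simp add: algebra_simps)
    have "norm ((1 + 4 * r) *\<^sub>R p) \<le> norm ((1 + 4 * r) *\<^sub>R p + 
       (r *\<^sub>R 1 - w * p * w + p * (p * p) + 2 *\<^sub>R ((r *\<^sub>R 1 - p) * (r *\<^sub>R 1 - p))))"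
      by (rule norm_mono[OF nonneg_scaleR[OF p] nonneg_add[OF 1 2]]) (simp add: r_def)
    also have "(1 + 4 * r) *\<^sub>R p + 
       (r *\<^sub>R 1 - w * p * w + p * (p * p) + 2 *\<^sub>R ((r *\<^sub>R 1 - p) * (r *\<^sub>R 1 - p))) = (r + 2 * r\<^sup>2) *\<^sub>R 1"
      unfolding wpw sq by (simp add: scaleR_add_left scaleR_add_right scaleR_diff_right power2_eq_square
          flip: scaleR_scaleR, simp add: algebra_simps, simp flip: scaleR_add_left)
    also have "norm ((r + 2 * r\<^sup>2) *\<^sub>R (1::'b)) \<le> r + 2 * r\<^sup>2"
      using norm_1_le by (simp add: mult_left_le r_def)
    finally have "(1 + 4 * r) * r \<le> r + 2 * r\<^sup>2"
      by (simp add: r_def)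
    then have "r\<^sup>2 \<le> 0" by (simp add: algebra_simps power2_eq_square)
    then have "norm p = 0" by (simp add: r_def)
    then show "c = 0" using cstar'[OF c] by (simp add: p_def)
  qed
  obtain t where t: "t > 0" "norm (t *\<^sub>R 1 + st c * c) \<le> t"
    using neg by (auto simp: nonneg_def)
  define s where "s = 1 / sqrt t"
  have s: "s * s = 1 / t" "s > 0" using t by (simp_all add: s_def)
  have e: "st (s *\<^sub>R c) * (s *\<^sub>R c) = (1 / t) *\<^sub>R (st c * c)"
    by (simp add: st_scaleR c s)
  have "s *\<^sub>R c = 0"
  proof (rule reduced)
    show "s *\<^sub>R c \<in> C" by (rule scaleR_in[OF c])
    show "nonneg (- (st (s *\<^sub>R c) * (s *\<^sub>R c)))"
      unfolding e using nonneg_scaleR[OF neg, of "1 / t"] t by simp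
    have "1 + (1 / t) *\<^sub>R (st c * c) = (1 / t) *\<^sub>R (t *\<^sub>R 1 + st c * c)"
      using t by (simp add: scaleR_add_right)
    then show "norm (1 + st (s *\<^sub>R c) * (s *\<^sub>R c)) \<le> 1"
      unfolding e using t by simp
  qed
  then show ?thesis using s by simp
qed

text \<open>The Kelley-Vaught argument. Let \<open>h = b* b\<close>, \<open>d = \<bar>h\<bar>\<close> the root of \<open>h\<^sup>2\<close>, and \<open>m = d - h\<close>
twice the negative part of \<open>h\<close>. Then \<open>m h = - m d\<close>, so \<open>c = b m\<close> satisfies \<open>c* c = m h m = - m d m\<close>
and vanishes by the previous lemma. This kills \<open>m\<close>, whence \<open>h = d\<close>.\<close>

lemma nonneg_st_mult:
  assumes b: "b \<in> C" shows "nonneg (st b * b)"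
proof -
  define h where "h = st b * b"
  have sh: "sa h" unfolding h_def by (rule sa_st_mult[OF b])
  obtain d where d: "nonneg d" "d * d = h * h" "\<And>y. h * h * y = y * (h * h) \<Longrightarrow> d * y = y * d"
    using nonneg_sqrt[OF nonneg_square[OF sh]] by metis
  have dh: "d * h = h * d" by (rule d(3)) (simp add: mult.assoc)
  obtain r where r: "nonneg r" "r * r = d" "\<And>y. d * y = y * d \<Longrightarrow> r * y = y * r"
    using nonneg_sqrt[OF d(1)] by metis
  have rh: "r * h = h * r" by (rule r(3)[OF dh])
  have rd: "r * d = d * r" by (rule r(3)) simp
  define m where "m = d - h"
  have sm: "sa m" by (simp add: m_def sa_diff sh nonneg_sa d(1))
  have mr: "m * r = r * m" by (simp add: m_def algebra_simps rh rd)
  have smr: "sa (m * r)" by (rule sa_mult[OF sm nonneg_sa[OF r(1)] mr])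
  have mdh: "m * h = - (m * d)" by (simp add: m_def algebra_simps d(2) dh)
  define c where "c = b * m"
  have cC: "c \<in> C" by (simp add: c_def mult_in b sa_in[OF sm])
  have "st c * c = m * h * m"
    by (simp add: c_def st_mult b sa_in[OF sm] sa_st[OF sm] h_def mult.assoc)
  also have "\<dots> = - (m * r * (r * m))" unfolding mdh by (simp add: r(2)[symmetric] mult.assoc)
  also have "r * m = m * r" by (rule mr[symmetric])
  finally have cc: "st c * c = - (m * r * (m * r))" .
  have "c = 0"
    by (rule st_mult_nonpos_imp_0[OF cC]) (simp add: cc nonneg_square[OF smr])
  then have "m * r * (m * r) = 0" using cc by simp
  then have "m * r = 0" by (rule sa_square_eq_0[OF smr])
  then have "m * d = 0" by (simp add: r(2)[symmetric] mult.assoc[symmetric])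
  moreover from this mdh have "m * h = 0" by simp
  ultimately have "m * m = 0" by (simp add: m_def right_diff_distrib)
  then have "m = 0" by (rule sa_square_eq_0[OF sm])
  then show ?thesis using d(1) by (simp add: m_def h_def)
qed

lemma nonneg_conjugate:
  assumes "nonneg z" "b \<in> C" shows "nonneg (b * z * st b)"
proof -
  obtain k where k: "nonneg k" "k * k = z" using nonneg_sqrt[OF assms(1)] by metis
  have kC: "k \<in> C" "st k = k" using k(1) by (simp_all add: nonneg_sa sa_in sa_st)
  have "b * z * st b = st (k * st b) * (k * st b)"
    by (simp add: k(2)[symmetric] st_mult kC st_in st_st assms(2) mult.assoc)
  then show ?thesis by (simp add: nonneg_st_mult mult_in kC st_in assms(2))
qed

text \<open>The cross terms of \<open>(b x + c y)(b x + c y)*\<close> are removed by the parallelogram law: add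
\<open>e e*\<close> for \<open>e = b x - c y\<close>.\<close>

lemma factorization_imp_majorization:
  assumes C: "b \<in> C" "c \<in> C" "x \<in> C" "y \<in> C" and a: "a = b * x + c * y"
  obtains l where "l > 0" "nonneg (l *\<^sub>R (b * st b + c * st c) - a * st a)"
proof -
  define t where "t = max 1 (max (norm (x * st x)) (norm (y * st y)))"
  have t: "t > 0" "norm (x * st x) \<le> t" "norm (y * st y) \<le> t" by (auto simp: t_def)
  define e where "e = b * x - c * y"
  have eC: "e \<in> C" by (simp add: e_def C mult_in diff_in)
  have "nonneg (b * (t *\<^sub>R 1 - x * st x) * st b)"
    by (intro nonneg_conjugate nonneg_norm_minus sa_mult_st t C)
  moreover have "nonneg (c * (t *\<^sub>R 1 - y * st y) * st c)"
    by (intro nonneg_conjugate nonneg_norm_minus sa_mult_st t C)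
  moreover have "nonneg (e * st e)"
    using nonneg_conjugate[OF nonneg_one eC] by simp
  ultimately have "nonneg (2 *\<^sub>R (b * (t *\<^sub>R 1 - x * st x) * st b)
      + 2 *\<^sub>R (c * (t *\<^sub>R 1 - y * st y) * st c) + e * st e)"
    by (simp add: nonneg_add nonneg_scaleR)
  also have "2 *\<^sub>R (b * (t *\<^sub>R 1 - x * st x) * st b)
      + 2 *\<^sub>R (c * (t *\<^sub>R 1 - y * st y) * st c) + e * st e
      = (2 * t) *\<^sub>R (b * st b + c * st c) - a * st a"
    by (simp add: a e_def C mult_in st_add st_diff st_mult algebra_simps scaleR_2 
        flip: scaleR_scaleR)
  finally show ?thesis using t(1) by (intro that[of "2 * t"]) simp_all
qed

end

section \<open>The Banach algebra of bounded endomorphisms\<close>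

text \<open>A copy of the bounded operators from a space to itself, so that composition can be the product of a type
class and the absolutely convergent series above apply. The class of unital rings is avoided,
since \<open>0 = 1\<close> on a trivial space.\<close>

typedef (overloaded) 'e endo = "UNIV :: ('e::real_normed_vector \<Rightarrow>\<^sub>L 'e) set"
  morphisms blinfun_of_endo Endo ..

setup_lifting type_definition_endo

instantiation endo :: (real_normed_vector) real_normed_algebra
begin

lift_definition norm_endo :: "'a endo \<Rightarrow> real" is norm .
lift_definition zero_endo :: "'a endo" is 0 .
lift_definition plus_endo :: "'a endo \<Rightarrow> 'a endo \<Rightarrow> 'a endo" is "(+)" .
lift_definition minus_endo :: "'a endo \<Rightarrow> 'a endo \<Rightarrow> 'a endo" is "(-)" .
lift_definition uminus_endo :: "'a endo \<Rightarrow> 'a endo" is uminus .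
lift_definition scaleR_endo :: "real \<Rightarrow> 'a endo \<Rightarrow> 'a endo" is scaleR .
lift_definition times_endo :: "'a endo \<Rightarrow> 'a endo \<Rightarrow> 'a endo" is blinfun_compose .

definition dist_endo :: "'a endo \<Rightarrow> 'a endo \<Rightarrow> real"
  where "dist_endo S T = norm (S - T)"
definition sgn_endo :: "'a endo \<Rightarrow> 'a endo"
  where "sgn_endo T = inverse (norm T) *\<^sub>R T"
definition [code del]: "(uniformity :: ('a endo \<times> 'a endo) filter) = (INF e\<in>{0<..}. principal {(S, T). dist S T < e})"
definition open_endo :: "'a endo set \<Rightarrow> bool"
  where [code del]: "open_endo U \<longleftrightarrow> (\<forall>S\<in>U. \<forall>\<^sub>F (S', T) in uniformity. S' = S \<longrightarrow> T \<in> U)"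

instance
proof
  note bil = bounded_bilinear_blinfun_compose
  fix R S T :: "'a endo" and a b :: real
  show "R + S + T = R + (S + T)" by transfer simp
  show "R + S = S + R" by transfer simp
  show "0 + R = R" by transfer simp
  show "- R + R = 0" by transfer simp
  show "R - S = R + - S" by transfer simp
  show "a *\<^sub>R (R + S) = a *\<^sub>R R + a *\<^sub>R S" by transfer (rule scaleR_add_right)
  show "(a + b) *\<^sub>R R = a *\<^sub>R R + b *\<^sub>R R" by transfer (rule scaleR_add_left)
  show "a *\<^sub>R b *\<^sub>R R = (a * b) *\<^sub>R R" by transfer simp
  show "1 *\<^sub>R R = R" by transfer simp
  show "R * S * T = R * (S * T)" by transfer (rule blinfun_eqI, simp)
  show "(R + S) * T = R * T + S * T" by transfer (rule bounded_bilinear.add_left[OF bil])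
  show "R * (S + T) = R * S + R * T" by transfer (rule bounded_bilinear.add_right[OF bil])
  show "a *\<^sub>R R * S = a *\<^sub>R (R * S)" by transfer (rule bounded_bilinear.scaleR_left[OF bil])
  show "R * a *\<^sub>R S = a *\<^sub>R (R * S)" by transfer (rule bounded_bilinear.scaleR_right[OF bil])
  show "norm R = 0 \<longleftrightarrow> R = 0" by transfer simp
  show "norm (R + S) \<le> norm R + norm S" by transfer (rule norm_triangle_ineq)
  show "norm (a *\<^sub>R R) = \<bar>a\<bar> * norm R" by transfer simp
  show "norm (R * S) \<le> norm R * norm S" by transfer (rule norm_blinfun_compose)
qed (simp_all add: dist_endo_def sgn_endo_def uniformity_endo_def open_endo_def)

end

instantiation endo :: (real_normed_vector) monoid_mult
begin

lift_definition one_endo :: "'a endo" is id_blinfun .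

instance
  by standard (transfer, rule blinfun_eqI, simp)+

end

instance endo :: (banach) banach
proof
  fix X :: "nat \<Rightarrow> 'a endo" assume "Cauchy X"
  have d: "dist S T = dist (blinfun_of_endo S) (blinfun_of_endo T)" for S T :: "'a endo"
    unfolding dist_endo_def dist_norm by transfer simp
  have "Cauchy (\<lambda>n. blinfun_of_endo (X n))"
    using \<open>Cauchy X\<close> unfolding Cauchy_def d .
  then obtain L where "(\<lambda>n. blinfun_of_endo (X n)) \<longlonglongrightarrow> L"
    using convergent_eq_Cauchy by blast
  then have "X \<longlonglongrightarrow> Endo L"
    unfolding lim_sequentially d by (simp add: Endo_inverse)
  then show "convergent X" by (rule convergentI)
qed

lift_definition ap :: "'e::real_normed_vector endo \<Rightarrow> 'e \<Rightarrow> 'e" is blinfun_apply .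

definition endo :: "('e::real_normed_vector \<Rightarrow> 'e) \<Rightarrow> 'e endo" where
  "endo f = Endo (Blinfun f)"

lemma ap_endo: "bounded_linear f \<Longrightarrow> ap (endo f) = f"
  by (simp add: ap.rep_eq endo_def Endo_inverse bounded_linear_Blinfun_apply)

lemma endo_eqI: "(\<And>x. ap S x = ap T x) \<Longrightarrow> S = T"
  by transfer (rule blinfun_eqI)

lemma norm_ap: "norm (ap T x) \<le> norm T * norm x"
  by transfer (rule norm_blinfun)

lemma norm_endo_bound: "\<lbrakk>0 \<le> b; \<And>x. norm (ap T x) \<le> b * norm x\<rbrakk> \<Longrightarrow> norm T \<le> b"
  by transfer (rule norm_blinfun_bound)

lemma ap_simps [simp]:
  "ap (S + T) x = ap S x + ap T x" "ap (S - T) x = ap S x - ap T x" "ap (- T) x = - ap T x"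
  "ap (a *\<^sub>R T) x = a *\<^sub>R ap T x" "ap (S * T) x = ap S (ap T x)" "ap 1 x = x" "ap 0 x = 0"
  by (transfer; simp add: blinfun.add_left blinfun.diff_left blinfun.minus_left blinfun.scaleR_left)+

lemma bounded_linear_ap_left: "bounded_linear (\<lambda>T. ap T x)"
  by (rule bounded_linear_intro[where K = "norm x"]) (simp_all add: norm_ap)

section \<open>Adjointable endomorphisms form a unital C*-algebra\<close>

lemma scaleC_minus_left: "(- c) *\<^sub>C x = - (c *\<^sub>C (x::'a::complex_vector))"
  using scaleC_scaleC[of "complex_of_real (- 1)" c x] unfolding scaleC_of_real by simp

lemma scaleC_1: "1 *\<^sub>C x = (x::'a::complex_vector)"
  using scaleC_of_real[of 1 x] by simp

lemma star_scaleR: "star (r *\<^sub>R x) = r *\<^sub>R star (x::'a::cstar_algebra)"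
  using star_scaleC[of "complex_of_real r" x] by (simp add: scaleC_of_real)

lemma star_minus: "star (- x) = - star (x::'a::cstar_algebra)"
  using star_scaleR[of "-1" x] by simp

lemma star_diff: "star (x - y) = star x - star (y::'a::cstar_algebra)"
  using star_add[of x "- y"] by (simp add: star_minus)

lemma star_0: "star (0::'a::cstar_algebra) = 0"
  using star_diff[of "0::'a" 0] by simp

text \<open>From \<open>norm b\<^sup>2 = norm (b* b) \<le> norm b* \<cdot> norm b\<close> and the same for \<open>b*\<close>.\<close>

lemma norm_star: "norm (star x) = norm (x::'a::cstar_algebra)"
proof -
  have le: "norm b \<le> norm (star b)" for b :: 'a
  proof (cases "norm b = 0")
    case False
    have "(norm b)\<^sup>2 \<le> norm (star b) * norm b"
      using norm_mult_ineq[of "star b" b] cstar_identity[of b] by simp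
    then show ?thesis using False by (simp add: power2_eq_square)
  qed simp
  show ?thesis using le[of x] le[of "star x"] by (simp add: star_star)
qed

locale sesquilinear_form =
  fixes ip :: "'e::complex_vector \<Rightarrow> 'e \<Rightarrow> 'a::cstar_algebra"
  assumes ip_add_left: "ip (x + y) z = ip x z + ip y z"
    and ip_scaleC_left: "ip (c *\<^sub>C x) y = c *\<^sub>C ip x y"
    and ip_star: "star (ip x y) = ip y x"
begin

lemma ip_scaleR_left: "ip (r *\<^sub>R x) y = r *\<^sub>R ip x y"
  using ip_scaleC_left[of "complex_of_real r" x y] by (simp add: scaleC_of_real)

lemma ip_diff_left: "ip (x - y) z = ip x z - ip y z"
  using ip_add_left[of x "(-1) *\<^sub>R y" z] ip_scaleR_left[of "-1" y z] by simp

lemma ip_zero_left: "ip 0 y = 0"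
  using ip_diff_left[of 0 0 y] by simp

lemma ip_add_right: "ip x (y + z) = ip x y + ip x z"
  by (simp only: ip_star[of _ x, symmetric] ip_add_left star_add)

lemma ip_scaleR_right: "ip x (r *\<^sub>R y) = r *\<^sub>R ip x y"
  by (simp only: ip_star[of _ x, symmetric] ip_scaleR_left star_scaleR)

lemma ip_scaleC_right: "ip x (c *\<^sub>C y) = cnj c *\<^sub>C ip x y"
  by (simp only: ip_star[of _ x, symmetric] ip_scaleC_left star_scaleC)

lemma ip_diff_right: "ip x (y - z) = ip x y - ip x z"
  by (simp only: ip_star[of _ x, symmetric] ip_diff_left star_diff)

lemma ip_zero_right: "ip x 0 = 0"
  using ip_diff_right[of x 0 0] by simp

lemma ip_minus_right: "ip x (- y) = - ip x y"
  using ip_diff_right[of x 0 y] by (simp add: ip_zero_right)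

end

text \<open>Positivity of \<open>ip x x\<close> is replaced by the Cauchy-Schwarz inequality, on which the
\<open>C\<^sup>*\<close>-identity for adjointable operators rests. The inequality is immediate for a
\<open>C\<^sup>*\<close>-algebra regarded as a module over itself, before anything is known about its
positive elements.\<close>

locale cauchy_schwarz_module = sesquilinear_form ip
  for ip :: "'e::{complex_vector,banach} \<Rightarrow> 'e \<Rightarrow> 'a::cstar_algebra" +
  assumes norm_ip_self: "norm (ip x x) = (norm x)\<^sup>2"
    and cauchy_schwarz: "norm (ip x y) \<le> norm x * norm y"
begin

lemma bounded_bilinear_ip: "bounded_bilinear ip"
  by standard (auto simp: ip_add_left ip_add_right ip_scaleR_left ip_scaleR_right
      intro!: exI[of _ 1] cauchy_schwarz)

lemma ip_self_eq_0: "ip x x = 0 \<Longrightarrow> x = 0"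
  using norm_ip_self[of x] by simp

lemma ip_eqI: assumes "\<And>z. ip z x = ip z y" shows "x = y"
  using ip_self_eq_0[of "x - y"] assms by (simp add: ip_diff_right)

lemma ip_eqI_left: assumes "\<And>z. ip x z = ip y z" shows "x = y"
  using ip_self_eq_0[of "x - y"] assms by (simp add: ip_diff_left)

lemma norm_scaleC_i: "norm (\<i> *\<^sub>C x) = norm (x::'e)"
proof -
  have "norm (ip (\<i> *\<^sub>C x) (\<i> *\<^sub>C x)) = norm (ip x x)"
    by (simp add: ip_scaleC_left ip_scaleC_right norm_scaleC)
  then show ?thesis by (simp add: norm_ip_self)
qed

definition imag_endo :: "'e endo" where "imag_endo = endo (\<lambda>x. \<i> *\<^sub>C x)"

lemma ap_imag_endo: "ap imag_endo = (\<lambda>x. \<i> *\<^sub>C x)"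
  unfolding imag_endo_def
proof (rule ap_endo, rule bounded_linear_intro[of _ 1])
  fix r and x :: 'e
  show "\<i> *\<^sub>C (r *\<^sub>R x) = r *\<^sub>R (\<i> *\<^sub>C x)"
    by (simp flip: scaleC_of_real add: scaleC_scaleC mult.commute)
qed (simp_all add: scaleC_add_right norm_scaleC_i)

definition endo_adjoint :: "'e endo \<Rightarrow> 'e endo \<Rightarrow> bool" where
  "endo_adjoint T S \<longleftrightarrow> is_adjoint ip (ap T) (ap S)"

lemma endo_adjointD: "endo_adjoint T S \<Longrightarrow> ip (ap T x) y = ip x (ap S y)"
  by (simp add: endo_adjoint_def is_adjoint_def)

lemma endo_adjoint_unique: "endo_adjoint T S \<Longrightarrow> endo_adjoint T S' \<Longrightarrow> S = S'"
proof (rule endo_eqI, rule ip_eqI)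
  fix x z assume "endo_adjoint T S" "endo_adjoint T S'"
  then show "ip z (ap S x) = ip z (ap S' x)"
    using endo_adjointD[of T S z x] endo_adjointD[of T S' z x] by simp
qed

lemma endo_adjoint_sym: "endo_adjoint T S \<Longrightarrow> endo_adjoint S T"
  unfolding endo_adjoint_def is_adjoint_def
proof (intro allI)
  fix x y assume "\<forall>x y. ip (ap T x) y = ip x (ap S y)"
  then have "star (ip (ap T y) x) = star (ip y (ap S x))" by simp
  then show "ip (ap S x) y = ip x (ap T y)" by (simp only: ip_star)
qed

definition adj_endos :: "'e endo set" where "adj_endos = {T. \<exists>S. endo_adjoint T S}"

definition endo_adj :: "'e endo \<Rightarrow> 'e endo" where "endo_adj T = (THE S. endo_adjoint T S)"

lemma endo_adj_eq: "endo_adjoint T S \<Longrightarrow> endo_adj T = S"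
  unfolding endo_adj_def by (rule the_equality) (auto intro: endo_adjoint_unique)

lemma endo_adj: "T \<in> adj_endos \<Longrightarrow> endo_adjoint T (endo_adj T)"
  by (auto simp: adj_endos_def endo_adj_eq)

lemma ip_endo_adj: "T \<in> adj_endos \<Longrightarrow> ip (ap T x) y = ip x (ap (endo_adj T) y)"
  by (rule endo_adjointD[OF endo_adj])

lemma endo_adjointI: "(\<And>x y. ip (ap T x) y = ip x (ap S y)) \<Longrightarrow> endo_adjoint T S"
  by (simp add: endo_adjoint_def is_adjoint_def)

lemma endo_adjoint_in: "endo_adjoint T S \<Longrightarrow> T \<in> adj_endos"
  by (auto simp: adj_endos_def)

lemma endo_adjoint_sa_iff: "T \<in> adj_endos \<and> endo_adj T = T \<longleftrightarrow> endo_adjoint T T"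
proof
  show "endo_adjoint T T" if "T \<in> adj_endos \<and> endo_adj T = T"
    using endo_adj[of T] that by simp
qed (simp add: endo_adj_eq endo_adjoint_in)

lemma norm_endo_square_le:
  assumes "endo_adjoint T S" shows "(norm T)\<^sup>2 \<le> norm (S * T)"
proof -
  have "norm (ap T x) \<le> sqrt (norm (S * T)) * norm x" for x
  proof (rule power2_le_imp_le)
    have "(norm (ap T x))\<^sup>2 = norm (ip x (ap (S * T) x))"
      by (simp add: endo_adjointD[OF assms] flip: norm_ip_self)
    also have "\<dots> \<le> norm x * (norm (S * T) * norm x)"
      by (rule order_trans[OF cauchy_schwarz]) (rule mult_left_mono[OF norm_ap], simp)
    finally show "(norm (ap T x))\<^sup>2 \<le> (sqrt (norm (S * T)) * norm x)\<^sup>2"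
      by (simp add: power_mult_distrib power2_eq_square mult_ac)
  qed simp
  then have "norm T \<le> sqrt (norm (S * T))" by (intro norm_endo_bound) auto
  then have "(norm T)\<^sup>2 \<le> (sqrt (norm (S * T)))\<^sup>2" by (intro power_mono) auto
  then show ?thesis by simp
qed

lemma norm_endo_adjoint_mult:
  assumes "endo_adjoint T S" shows "norm (S * T) = (norm T)\<^sup>2"
proof -
  have le: "norm U \<le> norm V" if "endo_adjoint U V" for U V
  proof (cases "norm U = 0")
    case False
    have "norm U * norm U \<le> norm V * norm U"
      using norm_endo_square_le[OF that] norm_mult_ineq[of V U] by (simp add: power2_eq_square)
    then show ?thesis using False by simp
  qed simp
  have "norm S = norm T"
    using le[OF assms] le[OF endo_adjoint_sym[OF assms]] by simp
  then have "norm (S * T) \<le> (norm T)\<^sup>2"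
    using norm_mult_ineq[of S T] by (simp add: power2_eq_square)
  then show ?thesis using norm_endo_square_le[OF assms] by simp
qed

text \<open>Symmetry is a family of equations between continuous functions of the operator.\<close>

lemma closed_symmetric_endos: "closed {T. endo_adjoint T T}"
proof -
  have "continuous_on UNIV (\<lambda>T. ip (ap T x) y)" "continuous_on UNIV (\<lambda>T. ip x (ap T y))" for x y
    by (intro linear_continuous_on bounded_linear_compose[OF bounded_bilinear.bounded_linear_left[OF bounded_bilinear_ip]]
        bounded_linear_compose[OF bounded_bilinear.bounded_linear_right[OF bounded_bilinear_ip]] bounded_linear_ap_left)+
  then show ?thesis
    unfolding endo_adjoint_def is_adjoint_def
    by (intro closed_Collect_all closed_Collect_eq)
qed

lemma endo_adjoint_intros:
  assumes "endo_adjoint S S'" "endo_adjoint T T'"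
  shows "endo_adjoint (S + T) (S' + T')" "endo_adjoint (S * T) (T' * S')"
    "endo_adjoint (r *\<^sub>R T) (r *\<^sub>R T')"
  using assms by (auto intro!: endo_adjointI
      simp: ip_add_left ip_add_right ip_scaleR_left ip_scaleR_right endo_adjointD)

lemma ap_scaleC_i: assumes "T \<in> adj_endos" shows "ap T (\<i> *\<^sub>C x) = \<i> *\<^sub>C ap T x"
  by (rule ip_eqI_left) (simp add: ip_endo_adj[OF assms] ip_scaleC_left)

lemma endo_adjoint_imag: "endo_adjoint imag_endo (- imag_endo)"
  by (rule endo_adjointI)
    (simp add: ap_imag_endo ip_scaleC_left ip_scaleC_right ip_minus_right scaleC_minus_left)

text \<open>From here on the positive cone of the abstract theory is available for adjointable operators.\<close>

sublocale unital_cstar adj_endos endo_adj imag_endo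
proof
  have "{T \<in> adj_endos. endo_adj T = T} = {T. endo_adjoint T T}"
    by (simp only: endo_adjoint_sa_iff)
  then show "closed {T \<in> adj_endos. endo_adj T = T}" by (simp add: closed_symmetric_endos)
  show "1 \<in> adj_endos" by (rule endo_adjoint_in[of _ 1], rule endo_adjointI) simp
  show "imag_endo \<in> adj_endos" by (rule endo_adjoint_in[OF endo_adjoint_imag])
  show "endo_adj imag_endo = - imag_endo" by (rule endo_adj_eq[OF endo_adjoint_imag])
  show "imag_endo * imag_endo = - 1"
    by (rule endo_eqI) (simp add: ap_imag_endo scaleC_scaleC scaleC_minus_left scaleC_1)
  fix S T assume S: "S \<in> adj_endos" and T: "T \<in> adj_endos"
  note adjs = endo_adj[OF S] endo_adj[OF T]
  show "S + T \<in> adj_endos" "endo_adj (S + T) = endo_adj S + endo_adj T"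
    using endo_adjoint_intros(1)[OF adjs] by (auto intro: endo_adjoint_in endo_adj_eq)
  show "S * T \<in> adj_endos" "endo_adj (S * T) = endo_adj T * endo_adj S"
    using endo_adjoint_intros(2)[OF adjs] by (auto intro: endo_adjoint_in endo_adj_eq)
  fix r :: real
  show "r *\<^sub>R T \<in> adj_endos" "endo_adj (r *\<^sub>R T) = r *\<^sub>R endo_adj T"
    using endo_adjoint_intros(3)[OF adjs] by (auto intro: endo_adjoint_in endo_adj_eq)
  show "endo_adj T \<in> adj_endos" "endo_adj (endo_adj T) = T"
    using endo_adjoint_sym[OF adjs(2)] by (auto intro: endo_adjoint_in endo_adj_eq)
  show "norm (endo_adj T * T) = (norm T)\<^sup>2" by (rule norm_endo_adjoint_mult[OF adjs(2)])
  show "imag_endo * T = T * imag_endo"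
    by (rule endo_eqI) (simp add: ap_imag_endo ap_scaleC_i[OF T])
qed

end

section \<open>Positive elements of a C*-algebra\<close>

text \<open>Linearity in the first argument forces the inner product \<open>x y*\<close>. Left multiplication is the module
action, so the adjointable operators include the right multiplications, and \<open>b \<mapsto> right_mult b\<close> embeds
the algebra, which may lack a unit, isometrically into a unital one.\<close>

interpretation self_module: cauchy_schwarz_module "\<lambda>x y :: 'a::cstar_algebra. x * star y"
proof
  fix x y z :: 'a and c
  show "(x + y) * star z = x * star z + y * star z" by (rule distrib_right)
  show "(c *\<^sub>C x) * star y = c *\<^sub>C (x * star y)" by (rule mult_scaleC_left)
  show "star (x * star y) = y * star x" by (simp add: star_mult star_star)
  show "norm (x * star x) = (norm x)\<^sup>2"
    using cstar_identity[of "star x"] by (simp add: star_star norm_star)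
  show "norm (x * star y) \<le> norm x * norm y"
    using norm_mult_ineq[of x "star y"] by (simp add: norm_star)
qed

definition right_mult :: "'a::cstar_algebra \<Rightarrow> 'a endo" where
  "right_mult b = endo (\<lambda>x. x * b)"

lemma ap_right_mult [simp]: "ap (right_mult b) x = x * b"
  by (simp add: right_mult_def ap_endo bounded_linear_mult_left)

lemma endo_adjoint_right_mult: "self_module.endo_adjoint (right_mult b) (right_mult (star b))"
  by (rule self_module.endo_adjointI) (simp add: star_mult star_star mult.assoc)

lemma right_mult_in: "right_mult b \<in> self_module.adj_endos"
  by (rule self_module.endo_adjoint_in[OF endo_adjoint_right_mult])

lemma right_mult_st: "self_module.endo_adj (right_mult b) = right_mult (star b)"
  by (rule self_module.endo_adj_eq[OF endo_adjoint_right_mult])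

lemma norm_right_mult: "norm (right_mult b) = norm b"
proof (rule antisym)
  show "norm (right_mult b) \<le> norm b"
    by (rule norm_endo_bound) (simp_all add: norm_mult_ineq mult.commute[of "norm b"])
  have "(norm b)\<^sup>2 \<le> norm (right_mult b) * norm b"
    using norm_ap[of "right_mult b" "star b"] by (simp add: cstar_identity norm_star)
  then show "norm b \<le> norm (right_mult b)"
    by (cases "norm b = 0") (auto simp: power2_eq_square)
qed

text \<open>Positivity tested among the operators on the algebra, where the abstract cone is closed under
addition.\<close>

definition cone_positive :: "'a::cstar_algebra \<Rightarrow> bool" where
  "cone_positive p \<longleftrightarrow> self_module.nonneg (right_mult p)"

lemma cstar_positive_imp_cone_positive:
  assumes "cstar_positive p" shows "cone_positive p"
proof -
  obtain b where b: "p = star b * b" using assms by (auto simp: cstar_positive_def)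
  have "right_mult p = self_module.endo_adj (right_mult (star b)) * right_mult (star b)"
    by (rule endo_eqI) (simp add: right_mult_st star_star b mult.assoc)
  then show ?thesis
    unfolding cone_positive_def by (simp only: self_module.nonneg_st_mult right_mult_in)
qed

lemma right_mult_add: "right_mult (p + q) = right_mult p + right_mult q"
  by (rule endo_eqI) (simp add: distrib_left)

lemma cone_positive_add: "\<lbrakk>cone_positive p; cone_positive q\<rbrakk> \<Longrightarrow> cone_positive (p + q)"
  unfolding cone_positive_def right_mult_add by (rule self_module.nonneg_add)

lemma cone_positive_scaleR: "\<lbrakk>cone_positive p; 0 \<le> c\<rbrakk> \<Longrightarrow> cone_positive (c *\<^sub>R p)"
proof -
  have "right_mult (c *\<^sub>R p) = c *\<^sub>R right_mult p" by (rule endo_eqI) simp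
  then show "\<lbrakk>cone_positive p; 0 \<le> c\<rbrakk> \<Longrightarrow> cone_positive (c *\<^sub>R p)"
    unfolding cone_positive_def by (simp only: self_module.nonneg_scaleR)
qed

lemma cone_positive_norm_mono: "\<lbrakk>cone_positive p; cone_positive q\<rbrakk> \<Longrightarrow> norm p \<le> norm (p + q)"
  unfolding cone_positive_def norm_right_mult[symmetric] right_mult_add by (rule self_module.norm_mono)

text \<open>The element is \<open>a (1 - h) a*\<close>. The missing unit, and with it the root \<open>k\<close> of \<open>1 - h\<close>, exists among the
operators on the algebra; applied to \<open>a\<close>, the root gives an honest element \<open>k a\<close> with
\<open>(k a)(k a)* = a (1 - h) a*\<close>.\<close>

lemma cstar_positive_contraction_defect:
  assumes h: "star h = h" "norm h \<le> 1"
  shows "cstar_positive (a * star a - a * h * star a)"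
proof -
  have "self_module.sa (right_mult h)"
    by (simp add: self_module.sa_def right_mult_in right_mult_st h)
  then obtain k where k: "self_module.sa k" "k * k = 1 - right_mult h"
    using self_module.sqrt_one_minus[of "right_mult h"] h(2) by (metis norm_right_mult)
  have kk: "self_module.endo_adj k = k" "k \<in> self_module.adj_endos"
    using k(1) by (simp_all add: self_module.sa_def)
  have "ap k a * star (ap k a) = a * star (ap (k * k) a)"
    using self_module.ip_endo_adj[OF kk(2), of a "ap k a"] by (simp add: kk(1))
  also have "\<dots> = a * star a - a * h * star a"
    by (simp add: k(2) star_diff star_mult h algebra_simps)
  finally show ?thesis
    unfolding cstar_positive_def by (intro exI[of _ "star (ap k a)"]) (simp add: star_star)
qed

section \<open>Open mappings and the method of continuity\<close>

text \<open>The open mapping theorem in the form of bounded preimages. By Baire's theorem the closure of the image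
of some ball of \<open>G\<close> has interior points, so every \<open>y\<close> in the image can be approximated within half of
its norm by the image of some \<open>u\<close> of controlled norm. Correcting the remainders successively gives a
geometric series of preimages.\<close>

lemma open_mapping_on_closed_subspace:
  fixes f :: "'x::banach \<Rightarrow> 'y::banach"
  assumes f: "bounded_linear f" and G: "subspace G" "closed G" and M: "closed (f ` G)"
  obtains K where "K > 0" "\<And>y. y \<in> f ` G \<Longrightarrow> \<exists>u\<in>G. f u = y \<and> norm u \<le> K * norm y"
proof -
  interpret f: bounded_linear f by (rule f)
  define M where "M = f ` G"
  have sM: "subspace M" unfolding M_def by (rule linear_subspace_image[OF f.linear G(1)])
  define F where "F n = closure (f ` (G \<inter> cball 0 (real n)))" for n
  have FM: "F n \<subseteq> M" for n
    unfolding F_def M_def by (rule closure_minimal[OF _ M]) auto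
  have cover: "(\<Union>n. F n) = M"
  proof
    show "M \<subseteq> (\<Union>n. F n)"
    proof
      fix y assume "y \<in> M"
      then obtain u where u: "u \<in> G" "y = f u" by (auto simp: M_def)
      obtain n where "norm u \<le> real n" using real_arch_simple by blast
      then have "y \<in> F n" unfolding F_def using u by (intro subsetD[OF closure_subset]) auto
      then show "y \<in> (\<Union>n. F n)" by blast
    qed
  qed (use FM in blast)
  have "\<exists>n. top_of_set M interior_of F n \<noteq> {}"
  proof (rule ccontr)
    assume "\<not> ?thesis"
    then have "top_of_set M interior_of \<Union>(range F) = {}"
    proof (intro Baire_category_alt disjI1 conjI)
      show "completely_metrizable_space (top_of_set M)"
        using M unfolding M_def by (intro completely_metrizable_space_closedin[OF completely_metrizable_space_euclidean]) simp
      fix T assume "T \<in> range F"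
      then obtain n where [simp]: "T = F n" by blast
      show "closedin (top_of_set M) T" using FM by (auto simp: F_def intro: closed_subset)
      show "top_of_set M interior_of T = {}" using \<open>\<not> _\<close> by simp
    qed auto
    moreover have "top_of_set M interior_of M = M"
      by (metis interior_of_topspace topspace_euclidean_subtopology)
    ultimately show False using cover subspace_0[OF sM] by auto
  qed
  then obtain n y0 where "y0 \<in> top_of_set M interior_of F n" by blast
  then obtain U where U: "openin (top_of_set M) U" "y0 \<in> U" "U \<subseteq> F n"
    by (auto simp: interior_of_def)
  then obtain e where e: "e > 0" "ball y0 e \<inter> M \<subseteq> U" and y0: "y0 \<in> M"
    by (metis openin_contains_ball openin_imp_subset subsetD)
  have approx_small: "\<exists>u\<in>G. norm u \<le> 2 * real n \<and> norm (y - f u) \<le> d"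
    if y: "y \<in> M" "norm y < e" and d: "d > 0" for y d
  proof -
    have near: "\<exists>u\<in>G. norm u \<le> real n \<and> norm (f u - w) < d / 2" if w: "w \<in> F n" for w
    proof -
      obtain z where "z \<in> f ` (G \<inter> cball 0 (real n))" "dist z w < d / 2"
        using w d unfolding F_def closure_approachable by (meson half_gt_zero)
      then show ?thesis by (auto simp: dist_norm)
    qed
    have "y0 + y \<in> ball y0 e" using y(2) by (simp add: dist_norm)
    then have "y0 + y \<in> F n" using U(3) e(2) subspace_add[OF sM y0 y(1)] by blast
    then obtain u1 where u1: "u1 \<in> G" "norm u1 \<le> real n" "norm (f u1 - (y0 + y)) < d / 2"
      using near by blast
    have "y0 \<in> F n" using U by blast
    then obtain u2 where u2: "u2 \<in> G" "norm u2 \<le> real n" "norm (f u2 - y0) < d / 2"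
      using near by blast
    have "y - f (u1 - u2) = (f u2 - y0) - (f u1 - (y0 + y))" by (simp add: f.diff)
    then have "norm (y - f (u1 - u2)) \<le> norm (f u2 - y0) + norm (f u1 - (y0 + y))"
      by (simp only: norm_triangle_ineq4)
    then have "norm (y - f (u1 - u2)) \<le> d" using u1(3) u2(3) by linarith
    moreover have "norm (u1 - u2) \<le> 2 * real n"
      using norm_triangle_ineq4[of u1 u2] u1 u2 by simp
    ultimately show ?thesis using subspace_diff[OF G(1) u1(1) u2(1)] by blast
  qed
  \<comment> \<open>A vector of norm \<open>e / 2\<close> has an approximate preimage of norm at most \<open>2 n\<close>; \<open>L\<close> is the quotient.\<close>
  define L where "L = 4 * real n / e"
  have L: "L \<ge> 0" using e by (simp add: L_def)
  have approx: "\<exists>u\<in>G. norm u \<le> L * norm y \<and> norm (y - f u) \<le> norm y / 2" if y: "y \<in> M" for y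
  proof (cases "y = 0")
    case True
    then show ?thesis using subspace_0[OF G(1)] by (intro bexI[of _ 0]) (auto simp: f.zero)
  next
    case False
    define a where "a = e / (2 * norm y)"
    have a: "a > 0" using e False by (simp add: a_def)
    have "norm (a *\<^sub>R y) < e" using e False by (simp add: a_def)
    then obtain u where u: "u \<in> G" "norm u \<le> 2 * real n" "norm (a *\<^sub>R y - f u) \<le> a * (norm y / 2)"
      using approx_small[of "a *\<^sub>R y" "a * (norm y / 2)"] subspace_scale[OF sM y] False a by auto
    define v where "v = (1 / a) *\<^sub>R u"
    have uv: "u = a *\<^sub>R v" using a by (simp add: v_def)
    have "a * norm (y - f v) \<le> a * (norm y / 2)"
      using u(3) a unfolding uv f.scaleR scaleR_diff_right[symmetric] by simp
    then have "norm (y - f v) \<le> norm y / 2" using a by simp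
    moreover have "norm v \<le> L * norm y"
      using u(2) a e False unfolding uv by (simp add: a_def L_def field_simps)
    moreover have "v \<in> G" using subspace_scale[OF G(1) u(1)] by (simp add: v_def)
    ultimately show ?thesis by blast
  qed
  then obtain g where g: "\<And>y. y \<in> M \<Longrightarrow> g y \<in> G \<and> norm (g y) \<le> L * norm y \<and> norm (y - f (g y)) \<le> norm y / 2"
    by metis
  have "\<exists>u\<in>G. f u = y \<and> norm u \<le> (2 * L + 1) * norm y" if y: "y \<in> M" for y
  proof -
    define r where "r k = ((\<lambda>r. r - f (g r)) ^^ k) y" for k
    have r_Suc: "r (Suc k) = r k - f (g (r k))" and r_0: "r 0 = y" for k by (simp_all add: r_def)
    have rM: "r k \<in> M" for k
    proof (induction k)
      case (Suc k)
      then show ?case using g[of "r k"] unfolding r_Suc by (intro subspace_diff[OF sM]) (auto simp: M_def)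
    qed (simp add: r_0 y)
    have nr: "norm (r k) \<le> norm y * (1 / 2) ^ k" for k
    proof (induction k)
      case (Suc k)
      then show ?case using g[OF rM[of k]] unfolding r_Suc by simp
    qed (simp add: r_0)
    define u where "u k = g (r k)" for k
    have uG: "u k \<in> G" for k using g[OF rM] by (simp add: u_def)
    have nu: "norm (u k) \<le> L * norm y * (1 / 2) ^ k" for k
    proof -
      have "norm (u k) \<le> L * norm (r k)" using g[OF rM] by (simp add: u_def)
      also have "\<dots> \<le> L * (norm y * (1 / 2) ^ k)" by (rule mult_left_mono[OF nr L])
      finally show ?thesis by (simp add: mult.assoc)
    qed
    have sg: "(\<lambda>k. L * norm y * (1 / 2) ^ k) sums (L * norm y * 2)"
      using sums_mult[OF geometric_sums[of "1 / 2 :: real"], of "L * norm y"] by simp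
    have sn: "summable (\<lambda>k. norm (u k))"
      by (rule summable_comparison_test'[OF sums_summable[OF sg], of 0]) (simp add: nu)
    have su: "u sums suminf u" using summable_norm_cancel[OF sn] by (rule summable_sums)
    have "suminf u \<in> G"
    proof -
      have "\<forall>m. (\<Sum>k<m. u k) \<in> G" by (simp add: subspace_sum[OF G(1)] uG)
      moreover have "(\<lambda>m. \<Sum>k<m. u k) \<longlonglongrightarrow> suminf u" using su by (simp add: sums_def)
      ultimately show ?thesis
        using G(2)[unfolded closed_sequential_limits, rule_format, of "\<lambda>m. \<Sum>k<m. u k"] by simp
    qed
    moreover have "f (suminf u) = y"
    proof -
      have "(\<lambda>k. f (u k)) sums f (suminf u)" by (rule f.sums[OF su])
      moreover have "(\<lambda>k. f (u k)) sums y"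
      proof -
        have "(\<lambda>k. norm y * (1 / 2) ^ k) \<longlonglongrightarrow> norm y * 0"
          by (intro tendsto_mult tendsto_const LIMSEQ_power_zero) simp
        then have lim0: "(\<lambda>k. norm y * (1 / 2) ^ k) \<longlonglongrightarrow> 0" by simp
        have "\<forall>\<^sub>F k in sequentially. norm (r k) \<le> norm y * (1 / 2) ^ k"
          by (intro always_eventually allI nr)
        then have "r \<longlonglongrightarrow> 0" using lim0 by (rule Lim_null_comparison)
        then have "(\<lambda>k. r k - r (Suc k)) sums (r 0 - 0)" by (rule telescope_sums')
        then show ?thesis by (simp add: r_Suc r_0 u_def)
      qed
      ultimately show ?thesis by (rule sums_unique2)
    qed
    moreover have "norm (suminf u) \<le> (2 * L + 1) * norm y"
    proof -
      have "norm (suminf u) \<le> (\<Sum>k. norm (u k))" by (rule summable_norm[OF sn])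
      also have "\<dots> \<le> L * norm y * 2"
        using suminf_le[OF nu sn sums_summable[OF sg]] sums_unique[OF sg] by simp
      also have "\<dots> \<le> (2 * L + 1) * norm y" by (simp add: algebra_simps)
      finally show ?thesis .
    qed
    ultimately show ?thesis by blast
  qed
  \<comment> \<open>The summand \<open>1\<close> keeps the constant positive when \<open>L = 0\<close>.\<close>
  then show ?thesis using that[of "2 * L + 1"] L unfolding M_def by auto
qed

text \<open>For \<open>s \<ge> 2 norm T\<close> the equation \<open>T x + s x = y\<close> is solved by a contraction. If it is solvable for
\<open>s + c / 2\<close>, the solution operator has norm at most \<open>1 / c\<close>, and rewriting the equation for \<open>s\<close> as
\<open>T x + (s + c / 2) x = y + (c / 2) x\<close> gives a contraction with factor \<open>1 / 2\<close>.\<close>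

lemma surj_of_uniformly_bounded_below:
  fixes T :: "'y::banach \<Rightarrow> 'y"
  assumes T: "bounded_linear T" and M: "closed M" "subspace M" "T ` M \<subseteq> M" and c: "c > 0"
    and below: "\<And>s x. \<lbrakk>0 \<le> s; x \<in> M\<rbrakk> \<Longrightarrow> c * norm x \<le> norm (T x + s *\<^sub>R x)"
  shows "y \<in> M \<Longrightarrow> \<exists>x\<in>M. T x = y"
proof -
  interpret T: bounded_linear T by (rule T)
  have M0: "complete M" "M \<noteq> {}"
    using M subspace_0[OF M(2)] by (auto simp: complete_eq_closed)
  define P where "P s \<longleftrightarrow> (\<forall>y\<in>M. \<exists>x\<in>M. T x + s *\<^sub>R x = y)" for s
  obtain K where K: "K > 0" "\<And>x. norm (T x) \<le> norm x * K" using T.pos_bounded by blast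
  have large: "P s" if s: "s \<ge> 2 * K" for s
    unfolding P_def
  proof
    fix y assume y: "y \<in> M"
    have s0: "s > 0" using s K by simp
    define h where "h x = (1 / s) *\<^sub>R (y - T x)" for x
    have "\<exists>!x\<in>M. h x = x"
    proof (rule Banach_fix[OF M0, of "1 / 2"])
      show "h ` M \<subseteq> M"
        using M(2,3) y by (auto simp: h_def intro!: subspace_scale subspace_diff)
      fix x x' assume "x \<in> M" "x' \<in> M"
      have "h x - h x' = (1 / s) *\<^sub>R (T (x' - x))"
        by (simp add: h_def T.diff scaleR_diff_right)
      then have "dist (h x) (h x') = (1 / s) * norm (T (x' - x))"
        using s0 by (simp add: dist_norm)
      also have "\<dots> \<le> (1 / s) * (norm (x' - x) * K)"
        using s0 by (intro mult_left_mono K) auto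
      also have "\<dots> = (K / s) * dist x x'" by (simp add: dist_norm norm_minus_commute)
      also have "\<dots> \<le> (1 / 2) * dist x x'"
        using s s0 K by (intro mult_right_mono) (auto simp: field_simps)
      finally show "dist (h x) (h x') \<le> (1 / 2) * dist x x'" .
    qed auto
    then obtain x where x: "x \<in> M" "h x = x" by blast
    have "s *\<^sub>R h x = y - T x" using s0 by (simp add: h_def)
    then show "\<exists>x\<in>M. T x + s *\<^sub>R x = y" using x by (intro bexI[of _ x]) auto
  qed
  have step: "P s" if s: "s \<ge> 0" and P: "P (s + c / 2)" for s
    unfolding P_def
  proof
    fix y assume y: "y \<in> M"
    obtain R where R: "\<And>z. z \<in> M \<Longrightarrow> R z \<in> M \<and> T (R z) + (s + c / 2) *\<^sub>R R z = z"
      using P unfolding P_def by metis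
    define h where "h x = R (y + (c / 2) *\<^sub>R x)" for x
    have hM: "y + (c / 2) *\<^sub>R x \<in> M" if "x \<in> M" for x
      using that y M(2) by (intro subspace_add subspace_scale)
    have "\<exists>!x\<in>M. h x = x"
    proof (rule Banach_fix[OF M0, of "1 / 2"])
      show "h ` M \<subseteq> M" using R hM by (auto simp: h_def)
      fix x x' assume x: "x \<in> M" "x' \<in> M"
      have "h x - h x' \<in> M"
        using R hM x M(2) by (auto simp: h_def intro!: subspace_diff)
      then have "c * norm (h x - h x') \<le> norm (T (h x - h x') + (s + c / 2) *\<^sub>R (h x - h x'))"
        using s c by (intro below) auto
      also have "T (h x - h x') + (s + c / 2) *\<^sub>R (h x - h x')
          = (T (h x) + (s + c / 2) *\<^sub>R h x) - (T (h x') + (s + c / 2) *\<^sub>R h x')"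
        by (simp add: T.diff scaleR_diff_right)
      also have "\<dots> = (c / 2) *\<^sub>R (x - x')"
        using R[OF hM[OF x(1)]] R[OF hM[OF x(2)]] by (simp add: h_def scaleR_diff_right)
      finally show "dist (h x) (h x') \<le> (1 / 2) * dist x x'"
        using c by (simp add: dist_norm)
    qed auto
    then obtain x where x: "x \<in> M" "h x = x" by blast
    have "T (h x) + (s + c / 2) *\<^sub>R h x = y + (c / 2) *\<^sub>R x"
      unfolding h_def using R[OF hM[OF x(1)]] by simp
    then have "T x + s *\<^sub>R x = y" by (simp add: x scaleR_add_left)
    then show "\<exists>x\<in>M. T x + s *\<^sub>R x = y" using x by blast
  qed
  have descend: "P (real n * (c / 2)) \<Longrightarrow> P 0" for n
  proof (induction n)
    case (Suc n)
    have "real (Suc n) * (c / 2) = real n * (c / 2) + c / 2" by (simp add: algebra_simps)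
    then have "P (real n * (c / 2) + c / 2)" using Suc.prems by (simp only:)
    then have "P (real n * (c / 2))" using c by (intro step[of "real n * (c / 2)"]) simp_all
    then show ?case by (rule Suc.IH)
  qed simp
  obtain n where "2 * K / (c / 2) \<le> real n" using real_arch_simple by blast
  then have "2 * K \<le> real n * (c / 2)" using c by (simp add: field_simps)
  then have "P 0" using descend large by blast
  then show "y \<in> M \<Longrightarrow> \<exists>x\<in>M. T x = y" by (simp add: P_def)
qed

section \<open>The Cauchy-Schwarz inequality in Hilbert modules\<close>

context hilbert_module begin

sublocale form: sesquilinear_form ip
  by standard (fact ip_add_left ip_scaleC_left ip_star)+

lemma cone_positive_ip: "cone_positive (ip x x)"
  by (rule cstar_positive_imp_cone_positive[OF ip_positive])

lemma norm_ip_self_eq: "norm (ip x x) = (norm x)\<^sup>2"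
  by (simp add: norm_eq)

text \<open>Put \<open>a = \<langle>y, x\<rangle>\<close> and expand \<open>\<langle>z, z\<rangle> \<ge> 0\<close> for \<open>z = y - a x\<close>. This yields
\<open>\<langle>y, y\<rangle> = a a* + (\<langle>z, z\<rangle> + a (1 - \<langle>x, x\<rangle>) a*)\<close>, a sum of positive elements, and
the norm is monotone on them.\<close>

lemma cauchy_schwarz_unit:
  assumes "norm x \<le> 1" shows "norm (ip y x) \<le> norm y"
proof -
  define a where "a = ip y x"
  define h where "h = ip x x"
  define z where "z = y - act a x"
  have ax: "ip (act a x) w = a * ip x w" for w by (rule ip_act_left)
  have xa: "ip w (act a x) = ip w x * star a" for w
    using ip_star[of "act a x" w] by (simp add: ax star_mult ip_star)
  have sa: "ip x y = star a" by (simp add: a_def ip_star)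
  have zz: "ip z z = ip y y - a * star a - a * star a + a * h * star a"
    by (simp add: z_def form.ip_diff_left form.ip_diff_right ax xa sa left_diff_distrib flip: a_def h_def mult.assoc)
  have "star h = h" by (simp add: h_def ip_star)
  moreover have "norm h \<le> 1" using assms by (simp add: h_def norm_ip_self_eq power_le_one)
  ultimately have "cone_positive (a * star a - a * h * star a)"
    by (intro cstar_positive_imp_cone_positive cstar_positive_contraction_defect)
  then have "cone_positive (ip z z + (a * star a - a * h * star a))"
    by (intro cone_positive_add cone_positive_ip)
  moreover have "cstar_positive (a * star a)"
    unfolding cstar_positive_def by (intro exI[of _ "star a"]) (simp add: star_star)
  ultimately have "norm (a * star a) \<le> norm (a * star a + (ip z z + (a * star a - a * h * star a)))"
    by (rule cone_positive_norm_mono[OF cstar_positive_imp_cone_positive, rotated])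
  also have "a * star a + (ip z z + (a * star a - a * h * star a)) = ip y y"
    by (simp add: zz)
  finally have "(norm a)\<^sup>2 \<le> (norm y)\<^sup>2"
    using self_module.norm_ip_self[of a] by (simp add: norm_ip_self_eq)
  then show ?thesis by (simp add: a_def power2_le_iff_abs_le)
qed

sublocale module: cauchy_schwarz_module ip
proof
  fix x y :: 'e
  show "norm (ip x x) = (norm x)\<^sup>2" by (rule norm_ip_self_eq)
  show "norm (ip x y) \<le> norm x * norm y"
  proof (cases "y = 0")
    case True
    then show ?thesis by (simp add: form.ip_zero_right)
  next
    case False
    define u where "u = (1 / norm y) *\<^sub>R y"
    have "norm u \<le> 1" using False by (simp add: u_def)
    from cauchy_schwarz_unit[OF this, of x] have "norm y * norm (ip x u) \<le> norm y * norm x"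
      by (intro mult_left_mono) auto
    moreover have "ip x y = norm y *\<^sub>R ip x u"
      using False by (simp add: u_def form.ip_scaleR_right)
    ultimately show ?thesis by (simp add: mult.commute)
  qed
qed

section \<open>Adjointable operators on a Hilbert module\<close>


lemma is_adjointD: "is_adjoint ip T S \<Longrightarrow> ip (T x) y = ip x (S y)"
  by (simp add: is_adjoint_def)

lemma is_adjoint_sym: assumes "is_adjoint ip T S" shows "is_adjoint ip S T"
  unfolding is_adjoint_def
proof (intro allI)
  fix x y
  have "star (ip (T y) x) = star (ip y (S x))" by (simp only: is_adjointD[OF assms])
  then show "ip (S x) y = ip x (T y)" by (simp only: ip_star)
qed

lemma adj_eqI: assumes "is_adjoint ip T S" shows "adj ip T = S"
  unfolding adj_def
proof (rule the_equality[where P = "is_adjoint ip T"])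
  fix S' assume "is_adjoint ip T S'"
  then have "ip x (S' y) = ip x (S y)" for x y
    using is_adjointD[of T S' x y] is_adjointD[OF assms, of x y] by simp
  then show "S' = S" by (intro ext module.ip_eqI)
qed (rule assms)

lemma is_adjoint_adj: "T \<in> adjointables ip \<Longrightarrow> is_adjoint ip T (adj ip T)"
  by (auto simp: adjointables_def adj_eqI)

lemma adjointables_I: "is_adjoint ip T S \<Longrightarrow> T \<in> adjointables ip"
  by (auto simp: adjointables_def)

lemma adj_in_adjointables: "T \<in> adjointables ip \<Longrightarrow> adj ip T \<in> adjointables ip"
  by (rule adjointables_I[OF is_adjoint_sym[OF is_adjoint_adj]])

lemma linear_adjoint: assumes "is_adjoint ip T S" shows "linear T"
proof
  fix x y r
  show "T (x + y) = T x + T y"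
    by (rule module.ip_eqI_left) (simp add: ip_add_left is_adjointD[OF assms])
  show "T (r *\<^sub>R x) = r *\<^sub>R T x"
    by (rule module.ip_eqI_left) (simp add: form.ip_scaleR_left is_adjointD[OF assms])
qed

text \<open>The closed graph theorem: the graph of \<open>T\<close> is cut out by the equations \<open>\<langle>y, z\<rangle> = \<langle>x, S z\<rangle>\<close>, and
bounded preimages under its projection to the domain are a bound for \<open>T\<close>.\<close>

lemma bounded_linear_adjointable:
  assumes "T \<in> adjointables ip" shows "bounded_linear T"
proof -
  obtain S where TS: "is_adjoint ip T S" using assms by (auto simp: adjointables_def)
  note lin = linear_adjoint[OF TS]
  define G where "G = range (\<lambda>x. (x, T x))"
  have "G = {p. \<forall>z. ip (snd p) z = ip (fst p) (S z)}"
  proof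
    show "{p. \<forall>z. ip (snd p) z = ip (fst p) (S z)} \<subseteq> G"
    proof
      fix p assume "p \<in> {p. \<forall>z. ip (snd p) z = ip (fst p) (S z)}"
      then have "snd p = T (fst p)"
        by (intro module.ip_eqI_left) (simp add: is_adjointD[OF TS])
      then show "p \<in> G" unfolding G_def by (metis prod.collapse rangeI)
    qed
  qed (auto simp: G_def is_adjointD[OF TS])
  moreover have "closed {p. \<forall>z. ip (snd p) z = ip (fst p) (S z)}"
  proof (intro closed_Collect_all closed_Collect_eq)
    note bl = bounded_bilinear.bounded_linear_left[OF module.bounded_bilinear_ip]
    fix z
    show "continuous_on UNIV (\<lambda>p :: 'e \<times> 'e. ip (snd p) z)"
      by (rule linear_continuous_on[OF bounded_linear_compose[OF bl bounded_linear_snd]])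
    show "continuous_on UNIV (\<lambda>p :: 'e \<times> 'e. ip (fst p) (S z))"
      by (rule linear_continuous_on[OF bounded_linear_compose[OF bl bounded_linear_fst]])
  qed
  ultimately have "closed G" by simp
  moreover have "linear (\<lambda>x. (x, T x))"
    by (rule linearI) (simp_all add: linear_add[OF lin] linear_cmul[OF lin])
  then have "subspace G"
    unfolding G_def by (rule linear_subspace_image[OF _ subspace_UNIV])
  moreover have fG: "fst ` G = UNIV" by (force simp: G_def)
  ultimately obtain K where K: "K > 0" "\<And>y. y \<in> fst ` G \<Longrightarrow> \<exists>u\<in>G. fst u = y \<and> norm u \<le> K * norm y"
    using open_mapping_on_closed_subspace[OF bounded_linear_fst, of G] by (metis closed_UNIV)
  have "norm (T x) \<le> norm x * K" for x
  proof -
    obtain u where u: "u \<in> G" "fst u = x" "norm u \<le> K * norm x" using K(2) fG by blast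
    then have "u = (x, T x)" by (auto simp: G_def)
    then show ?thesis using norm_snd_le[of "T x" x] u(3) by (simp add: mult.commute)
  qed
  then show ?thesis by (intro bounded_linear_intro) (auto simp: linear_add[OF lin] linear_cmul[OF lin])
qed

lemma ap_endo_adjointable: "T \<in> adjointables ip \<Longrightarrow> ap (endo T) = T"
  by (rule ap_endo[OF bounded_linear_adjointable])

lemma endo_adjoint_endo:
  assumes "T \<in> adjointables ip" shows "module.endo_adjoint (endo T) (endo (adj ip T))"
  unfolding module.endo_adjoint_def
  using assms by (simp add: ap_endo_adjointable adj_in_adjointables is_adjoint_adj)

lemma endo_in_adj_endos: "T \<in> adjointables ip \<Longrightarrow> endo T \<in> module.adj_endos"
  by (rule module.endo_adjoint_in[OF endo_adjoint_endo])

lemma ap_endo_adj: "T \<in> adjointables ip \<Longrightarrow> ap (module.endo_adj (endo T)) = adj ip T"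
  using module.endo_adj_eq[OF endo_adjoint_endo, of T] by (simp add: ap_endo_adjointable adj_in_adjointables)

lemma is_adjoint_sa: "module.sa h \<Longrightarrow> is_adjoint ip (ap h) (ap h)"
  using module.endo_adj[of h] by (simp add: module.sa_def module.endo_adjoint_def)

lemma self_adjoint_sa: "module.sa h \<Longrightarrow> self_adjoint ip (ap h)"
  unfolding self_adjoint_def by (metis adjointables_I adj_eqI is_adjoint_sa)

text \<open>The cone is made of squares of self-adjoint elements, and such an element is the factor that the order on
operators asks for.\<close>

lemma op_le_of_nonneg:
  assumes "module.sa S" "module.sa T" "module.nonneg (T - S)"
  shows "op_le ip (ap S) (ap T)"
proof -
  obtain k where k: "module.nonneg k" "k * k = T - S"
    using module.nonneg_sqrt[OF assms(3)] by metis
  have adjoint: "is_adjoint ip (ap k) (ap k)" by (rule is_adjoint_sa[OF module.nonneg_sa[OF k(1)]])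
  have "op_positive ip (\<lambda>x. ap T x - ap S x)"
    unfolding op_positive_def
  proof
    show "ap k \<in> adjointables ip" by (rule adjointables_I[OF adjoint])
    have "ap T x - ap S x = ap (k * k) x" for x by (simp only: k(2) ap_simps)
    then show "(\<lambda>x. ap T x - ap S x) = adj ip (ap k) \<circ> ap k"
      by (simp add: adj_eqI[OF adjoint] fun_eq_iff)
  qed
  then show ?thesis using assms by (simp add: op_le_def self_adjoint_sa)
qed

lemma majorized_if_factorized:
  assumes adjs: "A \<in> adjointables ip" "B1 \<in> adjointables ip" "B2 \<in> adjointables ip"
      "X \<in> adjointables ip" "Y \<in> adjointables ip"
    and A: "A = (\<lambda>x. (B1 \<circ> X) x + (B2 \<circ> Y) x)"
  shows "\<exists>l>0. op_le ip (A \<circ> adj ip A)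
           (\<lambda>x. l *\<^sub>R ((B1 \<circ> adj ip B1) x + (B2 \<circ> adj ip B2) x))"
proof -
  note ap_eq = adjs[THEN ap_endo_adjointable] adjs[THEN ap_endo_adj]
  note C = adjs[THEN endo_in_adj_endos]
  let ?a = "endo A" and ?b = "endo B1" and ?c = "endo B2" and ?st = module.endo_adj
  have "?a = ?b * endo X + ?c * endo Y"
    by (rule endo_eqI) (simp add: ap_eq, simp add: A)
  then obtain l where l: "l > 0" "module.nonneg (l *\<^sub>R (?b * ?st ?b + ?c * ?st ?c) - ?a * ?st ?a)"
    by (rule module.factorization_imp_majorization[OF C(2,3,4,5)])
  have "op_le ip (ap (?a * ?st ?a)) (ap (l *\<^sub>R (?b * ?st ?b + ?c * ?st ?c)))"
    by (intro op_le_of_nonneg module.sa_scaleR module.sa_add module.sa_mult_st C l)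
  also have "ap (?a * ?st ?a) = A \<circ> adj ip A" by (simp add: fun_eq_iff ap_eq)
  also have "ap (l *\<^sub>R (?b * ?st ?b + ?c * ?st ?c)) =
      (\<lambda>x. l *\<^sub>R ((B1 \<circ> adj ip B1) x + (B2 \<circ> adj ip B2) x))"
    by (simp add: fun_eq_iff ap_eq)
  finally show ?thesis using l(1) by blast
qed

lemma norm_square_le_ip_sum:
  assumes "p = ip x x + q" "cone_positive q"
  shows "(norm x)\<^sup>2 \<le> norm p"
  using cone_positive_norm_mono[OF cone_positive_ip assms(2), of x] assms(1) by (simp add: norm_ip_self_eq)

text \<open>The operator \<open>B B*\<close> for the row operator \<open>B (u, v) = B1 u + B2 v\<close>.\<close>

definition gram :: "('e \<Rightarrow> 'e) \<Rightarrow> ('e \<Rightarrow> 'e) \<Rightarrow> 'e \<Rightarrow> 'e" where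
  "gram B1 B2 x = B1 (adj ip B1 x) + B2 (adj ip B2 x)"

text \<open>Write \<open>y = B1 u + B2 v\<close> with \<open>u, v\<close> of norm at most \<open>K norm y\<close>. Then
\<open>\<langle>y, y\<rangle> = \<langle>u, B1* y\<rangle> + \<langle>v, B2* y\<rangle>\<close>, and each \<open>(norm (Bi* y))\<^sup>2\<close> is at most
\<open>norm \<langle>T y + s y, y\<rangle>\<close>, because the inner product is the sum of
\<open>\<langle>B1* y, B1* y\<rangle>\<close>, \<open>\<langle>B2* y, B2* y\<rangle>\<close> and \<open>s \<langle>y, y\<rangle>\<close>.\<close>

lemma gram_bounded_below:
  assumes B: "B1 \<in> adjointables ip" "B2 \<in> adjointables ip" and closed: "closed (range B1 + range B2)"
  obtains c where "c > 0"
    "\<And>s y. \<lbrakk>0 \<le> s; y \<in> range B1 + range B2\<rbrakk> \<Longrightarrow> c * norm y \<le> norm (gram B1 B2 y + s *\<^sub>R y)"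
proof -
  let ?f = "\<lambda>p. B1 (fst p) + B2 (snd p)"
  note adj = B[THEN is_adjoint_adj]
  have f: "bounded_linear ?f"
    by (intro bounded_linear_add bounded_linear_compose[OF bounded_linear_adjointable[OF B(1)]]
        bounded_linear_compose[OF bounded_linear_adjointable[OF B(2)]] bounded_linear_fst bounded_linear_snd)
  have rf: "?f ` UNIV = range B1 + range B2"
    by (force simp: set_plus_def image_iff)
  obtain K where K: "K > 0" "\<And>y. y \<in> ?f ` UNIV \<Longrightarrow> \<exists>u\<in>UNIV. ?f u = y \<and> norm u \<le> K * norm y"
    using open_mapping_on_closed_subspace[OF f subspace_UNIV closed_UNIV] closed unfolding rf by metis
  \<comment> \<open>The estimates below give \<open>norm y \<le> 2 K \<surd>D\<close> with \<open>D = norm (T y + s y) \<cdot> norm y\<close>.\<close>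
  define c where "c = 1 / (4 * K\<^sup>2)"
  have "c * norm y \<le> norm (gram B1 B2 y + s *\<^sub>R y)" if s: "0 \<le> s" and y: "y \<in> range B1 + range B2" for s y
  proof (cases "y = 0")
    case False
    define D where "D = norm (gram B1 B2 y + s *\<^sub>R y) * norm y"
    let ?b1 = "adj ip B1 y" and ?b2 = "adj ip B2 y"
    have eq: "ip (gram B1 B2 y + s *\<^sub>R y) y = ip ?b1 ?b1 + (ip ?b2 ?b2 + s *\<^sub>R ip y y)"
      by (simp add: gram_def ip_add_left form.ip_scaleR_left is_adjointD[OF adj(1)] is_adjointD[OF adj(2)])
    have D: "norm (ip (gram B1 B2 y + s *\<^sub>R y) y) \<le> D" unfolding D_def by (rule module.cauchy_schwarz)
    have "(norm ?b1)\<^sup>2 \<le> norm (ip (gram B1 B2 y + s *\<^sub>R y) y)"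
      by (rule norm_square_le_ip_sum[OF eq]) (intro cone_positive_add cone_positive_ip cone_positive_scaleR s)
    then have b1: "norm ?b1 \<le> sqrt D" using D by (intro real_le_rsqrt) simp
    have "(norm ?b2)\<^sup>2 \<le> norm (ip (gram B1 B2 y + s *\<^sub>R y) y)"
    proof (rule norm_square_le_ip_sum)
      show "ip (gram B1 B2 y + s *\<^sub>R y) y = ip ?b2 ?b2 + (ip ?b1 ?b1 + s *\<^sub>R ip y y)"
        unfolding eq by simp
    qed (intro cone_positive_add cone_positive_ip cone_positive_scaleR s)
    then have b2: "norm ?b2 \<le> sqrt D" using D by (intro real_le_rsqrt) simp
    obtain w where w: "?f w = y" "norm w \<le> K * norm y" using K(2) y unfolding rf by blast
    have fs: "norm (fst w) \<le> K * norm y" "norm (snd w) \<le> K * norm y"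
      using w(2) norm_fst_le[of "fst w" "snd w"] norm_snd_le[of "snd w" "fst w"] by simp_all
    have "ip y y = ip (fst w) ?b1 + ip (snd w) ?b2"
      by (subst w(1)[symmetric]) (simp add: ip_add_left is_adjointD[OF adj(1)] is_adjointD[OF adj(2)])
    then have "(norm y)\<^sup>2 \<le> norm (ip (fst w) ?b1) + norm (ip (snd w) ?b2)"
      using norm_triangle_ineq norm_ip_self_eq by metis
    also have "\<dots> \<le> (K * norm y) * sqrt D + (K * norm y) * sqrt D"
      by (intro add_mono order_trans[OF module.cauchy_schwarz] mult_mono fs b1 b2)
        (use K in auto)
    finally have "norm y * norm y \<le> norm y * (2 * K * sqrt D)"
      by (simp add: power2_eq_square mult_ac)
    then have "norm y \<le> 2 * K * sqrt D" using False by simp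
    then have "(norm y)\<^sup>2 \<le> (2 * K * sqrt D)\<^sup>2" by (intro power_mono) auto
    also have "\<dots> = 4 * K\<^sup>2 * D" by (simp add: power_mult_distrib D_def)
    finally have "norm y * norm y \<le> norm y * (4 * K\<^sup>2 * norm (gram B1 B2 y + s *\<^sub>R y))"
      by (simp add: D_def power2_eq_square mult_ac)
    then have "norm y \<le> 4 * K\<^sup>2 * norm (gram B1 B2 y + s *\<^sub>R y)" using False by simp
    then show ?thesis using K(1) by (simp add: c_def field_simps)
  qed simp
  moreover have "c > 0" using K(1) by (simp add: c_def)
  ultimately show ?thesis using that by blast
qed

lemma subspace_range_sum:
  assumes "B1 \<in> adjointables ip" "B2 \<in> adjointables ip" shows "subspace (range B1 + range B2)"
proof -
  note lin = assms[THEN bounded_linear_adjointable, THEN bounded_linear.linear]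
  have "range B1 + range B2 = {x + y |x y. x \<in> range B1 \<and> y \<in> range B2}"
    unfolding set_plus_def by blast
  then show ?thesis
    using subspace_sums[OF lin[THEN linear_subspace_image, OF subspace_UNIV]] by (simp only:)
qed

lemma gram_right_inverse:
  assumes B: "B1 \<in> adjointables ip" "B2 \<in> adjointables ip" and closed: "closed (range B1 + range B2)"
  obtains G where "\<And>z. z \<in> range B1 + range B2 \<Longrightarrow> G z \<in> range B1 + range B2"
    "\<And>z. z \<in> range B1 + range B2 \<Longrightarrow> gram B1 B2 (G z) = z"
proof -
  obtain c where c: "c > 0"
    "\<And>s y. \<lbrakk>0 \<le> s; y \<in> range B1 + range B2\<rbrakk> \<Longrightarrow> c * norm y \<le> norm (gram B1 B2 y + s *\<^sub>R y)"
    using gram_bounded_below[OF B closed] by blast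
  have "bounded_linear (\<lambda>x. B1 (adj ip B1 x) + B2 (adj ip B2 x))"
    by (intro bounded_linear_add
        bounded_linear_compose[OF bounded_linear_adjointable bounded_linear_adjointable[OF adj_in_adjointables]] B)
  then have "bounded_linear (gram B1 B2)" by (simp only: gram_def[abs_def])
  moreover have "gram B1 B2 ` (range B1 + range B2) \<subseteq> range B1 + range B2"
    by (auto simp: gram_def intro: set_plus_intro)
  ultimately have "\<exists>x\<in>range B1 + range B2. gram B1 B2 x = z" if "z \<in> range B1 + range B2" for z
    by (rule surj_of_uniformly_bounded_below[OF _ closed subspace_range_sum[OF B] _ c that])
  then show ?thesis using that by metis
qed

lemma gram_symmetric:
  assumes "B1 \<in> adjointables ip" "B2 \<in> adjointables ip"
  shows "ip (gram B1 B2 x) y = ip x (gram B1 B2 y)"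
  using is_adjointD[OF is_adjoint_adj[OF assms(1)]] is_adjointD[OF is_adjoint_adj[OF assms(2)]]
    is_adjointD[OF is_adjoint_sym[OF is_adjoint_adj[OF assms(1)]]]
    is_adjointD[OF is_adjoint_sym[OF is_adjoint_adj[OF assms(2)]]]
  by (simp add: gram_def ip_add_left form.ip_add_right)

text \<open>With \<open>G\<close> inverting \<open>T = gram B1 B2\<close> on the closed range, \<open>X = B1* G A\<close> and \<open>Y = B2* G A\<close>.
Symmetry of \<open>T\<close> moves \<open>G\<close> across the inner product on that range, so \<open>X\<close> and \<open>Y\<close> are adjointable,
although \<open>G\<close> is only an arbitrary choice of preimages.\<close>

lemma factorized_if_range_subset:
  assumes A: "A \<in> adjointables ip" and B: "B1 \<in> adjointables ip" "B2 \<in> adjointables ip"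
    and closed: "closed (range B1 + range B2)" and range: "range A \<subseteq> range B1 + range B2"
  shows "\<exists>X \<in> adjointables ip. \<exists>Y \<in> adjointables ip. A = (\<lambda>x. (B1 \<circ> X) x + (B2 \<circ> Y) x)"
proof -
  let ?M = "range B1 + range B2" and ?T = "gram B1 B2"
  obtain G where G: "\<And>z. z \<in> ?M \<Longrightarrow> G z \<in> ?M" "\<And>z. z \<in> ?M \<Longrightarrow> ?T (G z) = z"
    using gram_right_inverse[OF B closed] by blast
  have AM: "A x \<in> ?M" for x using range by blast
  have *: "adj ip B \<circ> G \<circ> A \<in> adjointables ip" if B': "B \<in> adjointables ip" and BM: "range B \<subseteq> ?M" for B
  proof (rule adjointables_I[of _ "adj ip A \<circ> G \<circ> B"], unfold is_adjoint_def, intro allI)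
    fix x y
    have "B y \<in> ?M" using BM by blast
    have "ip (adj ip B (G (A x))) y = ip (G (A x)) (?T (G (B y)))"
      using is_adjointD[OF is_adjoint_sym[OF is_adjoint_adj[OF B']]] G(2)[OF \<open>B y \<in> ?M\<close>] by simp
    also have "\<dots> = ip (?T (G (A x))) (G (B y))" by (rule gram_symmetric[OF B, symmetric])
    also have "\<dots> = ip x (adj ip A (G (B y)))"
      by (simp add: G(2)[OF AM] is_adjointD[OF is_adjoint_adj[OF A]])
    finally show "ip ((adj ip B \<circ> G \<circ> A) x) y = ip x ((adj ip A \<circ> G \<circ> B) y)" by simp
  qed
  have 0: "0 \<in> range B1" "0 \<in> range B2"
    using linear_0[OF linear_adjoint[OF is_adjoint_adj[OF B(1)]]] 
      linear_0[OF linear_adjoint[OF is_adjoint_adj[OF B(2)]]] by (metis rangeI)+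
  have "range B1 \<subseteq> ?M" "range B2 \<subseteq> ?M"
    using set_plus_intro[OF _ 0(2)] set_plus_intro[OF 0(1)] by force+
  moreover have "A x = (B1 \<circ> (adj ip B1 \<circ> G \<circ> A)) x + (B2 \<circ> (adj ip B2 \<circ> G \<circ> A)) x" for x
    using G(2)[OF AM[of x]] by (simp add: gram_def)
  ultimately show ?thesis using * B by blast
qed

text \<open>For \<open>w\<close> in the kernel of \<open>T = gram B1 B2\<close>, majorization gives \<open>A* w = 0\<close>, and
\<open>\<langle>T w, w\<rangle> = 0\<close> gives \<open>B1* w = B2* w = 0\<close>, that is, \<open>w\<close> is orthogonal to the closed range.
Applied to \<open>w = x - P x\<close> with \<open>P = G T\<close>, this shows \<open>\<langle>a, x\<rangle> = \<langle>P a, x\<rangle>\<close> for all \<open>a\<close> in the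
range of \<open>A\<close> and all \<open>x\<close>.\<close>

lemma range_subset_if_majorized:
  assumes A: "A \<in> adjointables ip" and B: "B1 \<in> adjointables ip" "B2 \<in> adjointables ip"
    and closed: "closed (range B1 + range B2)"
    and le: "op_le ip (A \<circ> adj ip A) (\<lambda>x. l *\<^sub>R ((B1 \<circ> adj ip B1) x + (B2 \<circ> adj ip B2) x))"
  shows "range A \<subseteq> range B1 + range B2"
proof -
  let ?M = "range B1 + range B2" and ?T = "gram B1 B2"
  note adjA = is_adjoint_adj[OF A] and adjB = B[THEN is_adjoint_adj]
  obtain G where G: "\<And>z. z \<in> ?M \<Longrightarrow> G z \<in> ?M" "\<And>z. z \<in> ?M \<Longrightarrow> ?T (G z) = z"
    using gram_right_inverse[OF B closed] by blast
  obtain S where S: "S \<in> adjointables ip" and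
    "(\<lambda>x. l *\<^sub>R ((B1 \<circ> adj ip B1) x + (B2 \<circ> adj ip B2) x) - (A \<circ> adj ip A) x) = adj ip S \<circ> S"
    using le by (auto simp: op_le_def op_positive_def)
  then have eq: "l *\<^sub>R ?T x - A (adj ip A x) = adj ip S (S x)" for x
    by (simp add: fun_eq_iff gram_def)
  have kerA: "adj ip A w = 0" if w: "?T w = 0" for w
  proof -
    have "ip (A (adj ip A w)) w + ip (adj ip S (S w)) w = 0"
      by (simp add: w form.ip_zero_left flip: eq ip_add_left)
    then have "0 = ip (adj ip A w) (adj ip A w) + ip (S w) (S w)"
      by (simp add: is_adjointD[OF adjA] is_adjointD[OF is_adjoint_sym[OF is_adjoint_adj[OF S]]])
    then have "(norm (adj ip A w))\<^sup>2 \<le> norm (0 :: 'a)"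
      by (rule norm_square_le_ip_sum[OF _ cone_positive_ip])
    then show ?thesis by simp
  qed
  have kerT: "ip m w = 0" if w: "?T w = 0" and m: "m \<in> ?M" for m w
  proof -
    have eq: "0 = ip (adj ip B1 w) (adj ip B1 w) + ip (adj ip B2 w) (adj ip B2 w)"
      using arg_cong[OF w, of "\<lambda>z. ip z w"]
      by (simp add: gram_def ip_add_left form.ip_zero_left is_adjointD[OF adjB(1)] is_adjointD[OF adjB(2)])
    have "(norm (adj ip B1 w))\<^sup>2 \<le> norm (0 :: 'a)"
      by (rule norm_square_le_ip_sum[OF eq cone_positive_ip])
    moreover have "(norm (adj ip B2 w))\<^sup>2 \<le> norm (0 :: 'a)"
      by (rule norm_square_le_ip_sum[OF eq[unfolded add.commute[of "ip (adj ip B1 w) (adj ip B1 w)"]] cone_positive_ip])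
    moreover obtain u v where "m = B1 u + B2 v" using m by (auto elim: set_plus_elim)
    ultimately show ?thesis
      by (simp add: ip_add_left is_adjointD[OF adjB(1)] is_adjointD[OF adjB(2)] form.ip_zero_right)
  qed
  define P where "P x = G (?T x)" for x
  have TM: "?T x \<in> ?M" for x by (auto simp: gram_def intro: set_plus_intro)
  have PM: "P x \<in> ?M" for x using G(1)[OF TM] by (simp add: P_def)
  have bT: "?T (x - y) = ?T x - ?T y" for x y
    by (rule module.ip_eqI_left) (simp add: gram_symmetric[OF B] form.ip_diff_left)
  have TP: "?T (x - P x) = 0" for x by (simp add: bT G(2)[OF TM] P_def)
  show ?thesis
  proof
    fix a assume "a \<in> range A"
    then obtain z where z: "a = A z" by blast
    have "ip a x = ip (P a) x" for x
    proof -
      have "ip a (x - P x) = 0"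
        unfolding z by (simp add: is_adjointD[OF adjA] kerA[OF TP] form.ip_zero_right)
      then have "ip a x = ip a (P x)" by (simp add: form.ip_diff_right)
      moreover have "star (ip (P x) (a - P a)) = 0" by (simp add: kerT[OF TP PM] star_0)
      then have "ip a (P x) = ip (P a) (P x)" by (simp add: ip_star form.ip_diff_left)
      moreover have "ip (P a) (x - P x) = 0" by (rule kerT[OF TP PM])
      then have "ip (P a) (P x) = ip (P a) x" by (simp add: form.ip_diff_right)
      ultimately show ?thesis by simp
    qed
    then have "a = P a" by (rule module.ip_eqI_left)
    then show "a \<in> ?M" using PM by metis
  qed
qed

end

section \<open>The equivalence\<close>

theorem theorem4p5:
  fixes act :: "'a::cstar_algebra \<Rightarrow> 'e::{complex_vector, banach} \<Rightarrow> 'e"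
    and ip :: "'e \<Rightarrow> 'e \<Rightarrow> 'a"
    and A B1 B2 :: "'e \<Rightarrow> 'e"
  assumes "hilbert_module act ip"
    and "A \<in> adjointables ip" and "B1 \<in> adjointables ip" and "B2 \<in> adjointables ip"
    and "closed (range B1 + range B2)"
  shows "(range A \<subseteq> range B1 + range B2 \<longleftrightarrow>
          (\<exists>lam::real. lam > 0 \<and>
             op_le ip (A \<circ> adj ip A)
               (\<lambda>x. lam *\<^sub>R ((B1 \<circ> adj ip B1) x + (B2 \<circ> adj ip B2) x))))
       \<and> ((\<exists>lam::real. lam > 0 \<and>
             op_le ip (A \<circ> adj ip A)
               (\<lambda>x. lam *\<^sub>R ((B1 \<circ> adj ip B1) x + (B2 \<circ> adj ip B2) x))) \<longleftrightarrow>
          (\<exists>X \<in> adjointables ip. \<exists>Y \<in> adjointables ip.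
             A = (\<lambda>x. (B1 \<circ> X) x + (B2 \<circ> Y) x)))"
    (is "(?range \<longleftrightarrow> ?majorized) \<and> (?majorized \<longleftrightarrow> ?factorized)")
proof -
  interpret hilbert_module act ip by (rule assms(1))
  have "?factorized" if "?range"
    by (rule factorized_if_range_subset[OF assms(2-5) that])
  moreover have "?majorized" if "?factorized"
    using that majorized_if_factorized[OF assms(2-4)] by blast
  moreover have "?range" if "?majorized"
    using that range_subset_if_majorized[OF assms(2-5)] by blast
  ultimately show ?thesis by argo
qed

end
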